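(* Let $n<d$, $\mathbf X\in\mathbb R^{n\times d}$ with $\mathbf X\mathbf X^\top$ non-singular, $\theta_S,\theta_T\in\mathbb R^d$ with $\theta_S\neq0$, and $\mathbf y=\mathbf X\theta_T$. Consider a depth-$L$ linear network with end-to-end vector $\beta(t)=\mathbf W_1(t)\mathbf W_2(t)\cdots\mathbf W_L(t)$. Suppose the weights before pretraining are 0-balanced, pretraining is by gradient flow and learns the source teacher perfectly, so that at the start of fine-tuning ($t=0$) $\beta(0)=\theta_S$. Fine-tuning is gradient flow on $L(\Theta)=\frac1n\|\mathbf X\beta-\mathbf y\|^2$ started from the pretrained weights, and assume $\lim_{t\to\infty}L(\Theta(t))=0$. Then $$\lim_{t\to\infty}\beta(t)=\left(\frac{\|\lim_{t\to\infty}\beta(t)\|}{\|\theta_S\|}\right)^{\frac{L-1}{L}}\mathbf P_\perp\theta_S+\mathbf P_\parallel\theta_T .$$ Moreover, if this holds for networks of every depth $L$ (with $\mathbf X,\theta_S,\theta_T$ fixed) and $\mathbf P_\parallel\theta_S\ne0$, then $$\lim_{L\to\infty}\lim_{t\to\infty}\beta(t)=\frac{\|\mathbf P_\parallel\theta_T\|}{\|\mathbf P_\parallel\theta_S\|}\,\mathbf P_\perp\theta_S+\mathbf P_\parallel\theta_T .$$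
   Context: $\mathbf P_\parallel=\mathbf X^\top(\mathbf X\mathbf X^\top)^{-1}\mathbf X$ is the orthogonal projection onto the row space of $\mathbf X$, and $\mathbf P_\perp=\mathbf I-\mathbf P_\parallel$. A depth-$L$ linear network has weights $\Theta=\{\mathbf W_1,\dots,\mathbf W_L\}$, $\mathbf W_j\in\mathbb R^{d_{j-1}\times d_j}$, with $d_0=d$, $d_L=1$ and $d_j\ge d$ for $1\le j\le L-1$; it computes $f(\mathbf x;\Theta)=\mathbf x^\top\beta$ with $\beta=\mathbf W_1\cdots\mathbf W_L$. The weights are 0-balanced if $\mathbf W_j^\top\mathbf W_j=\mathbf W_{j+1}\mathbf W_{j+1}^\top$ for all $j\in\{1,\dots,L-1\}$. Gradient flow on a loss $\ell$ means $\dot{\mathbf W}_j(t)=-\partial \ell(\Theta(t))/\partial\mathbf W_j(t)$ for all $j$. Pretraining is gradient flow on $\frac1{n_S}\|\mathbf X_S\beta-\mathbf y_S\|^2$ where $\mathbf X_S\in\mathbb R^{n_S\times d}$ and $\mathbf y_S=\mathbf X_S\theta_S$; the resulting weights are the initial weights $\Theta(0)$ of fine-tuning. *)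

theory Defs
  imports
    "HOL-Analysis.Derivative"
    "Jordan_Normal_Form.Gauss_Jordan_Elimination"
begin

subsection \<open>Euclidean norm, limits and projections\<close>

definition euclid_norm :: "real vec \<Rightarrow> real" where
  "euclid_norm v = sqrt (scalar_prod v v)"

text \<open>The types of vectors and matrices carry no topology; convergence in a
  finite-dimensional space is convergence of every entry.\<close>

definition vec_tendsto :: "('a \<Rightarrow> real vec) \<Rightarrow> real vec \<Rightarrow> 'a filter \<Rightarrow> bool" where
  "vec_tendsto f v F \<longleftrightarrow>
     (\<forall>\<^sub>F x in F. dim_vec (f x) = dim_vec v) \<and>
     (\<forall>i<dim_vec v. ((\<lambda>x. f x $ i) \<longlongrightarrow> v $ i) F)"

definition mat_tendsto :: "('a \<Rightarrow> real mat) \<Rightarrow> real mat \<Rightarrow> 'a filter \<Rightarrow> bool" where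
  "mat_tendsto f A F \<longleftrightarrow>
     (\<forall>\<^sub>F x in F. dim_row (f x) = dim_row A \<and> dim_col (f x) = dim_col A) \<and>
     (\<forall>i<dim_row A. \<forall>k<dim_col A. ((\<lambda>x. f x $$ (i, k)) \<longlongrightarrow> A $$ (i, k)) F)"

text \<open>Meaningful when \<open>X * transpose_mat X\<close> is invertible; otherwise
  \<^const>\<open>mat_inverse\<close> returns \<^const>\<open>None\<close>.\<close>

definition P_par :: "real mat \<Rightarrow> real mat" where
  "P_par X = transpose_mat X * the (mat_inverse (X * transpose_mat X)) * X"

definition P_perp :: "real mat \<Rightarrow> real mat" where
  "P_perp X = 1\<^sub>m (dim_col X) - P_par X"

subsection \<open>Deep linear networks\<close>

text \<open>A depth-\<open>L\<close> network has widths \<open>w 0, \<dots>, w L\<close> and weight matrices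
  \<open>\<Theta> 1, \<dots>, \<Theta> L\<close>; the values of \<open>\<Theta>\<close> at other indices are irrelevant.\<close>

definition architecture :: "nat \<Rightarrow> nat \<Rightarrow> (nat \<Rightarrow> nat) \<Rightarrow> bool" where
  "architecture d L w \<longleftrightarrow> 1 \<le> L \<and> w 0 = d \<and> w L = 1 \<and> (\<forall>j. 1 \<le> j \<and> j \<le> L - 1 \<longrightarrow> d \<le> w j)"

definition is_weights :: "nat \<Rightarrow> (nat \<Rightarrow> nat) \<Rightarrow> (nat \<Rightarrow> real mat) \<Rightarrow> bool" where
  "is_weights L w \<Theta> \<longleftrightarrow> (\<forall>j\<in>{1..L}. \<Theta> j \<in> carrier_mat (w (j - 1)) (w j))"

text \<open>The product \<open>\<Theta> 1 * \<dots> * \<Theta> L\<close> is a \<open>d \<times> 1\<close> matrix; its only column is the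
  end-to-end vector.\<close>

definition end_to_end :: "nat \<Rightarrow> (nat \<Rightarrow> real mat) \<Rightarrow> real vec" where
  "end_to_end L \<Theta> = col (foldr (*) (map \<Theta> [1..<Suc L]) (1\<^sub>m 1)) 0"

definition zero_balanced :: "nat \<Rightarrow> (nat \<Rightarrow> real mat) \<Rightarrow> bool" where
  "zero_balanced L \<Theta> \<longleftrightarrow>
     (\<forall>j. 1 \<le> j \<and> j \<le> L - 1 \<longrightarrow>
        transpose_mat (\<Theta> j) * \<Theta> j = \<Theta> (j + 1) * transpose_mat (\<Theta> (j + 1)))"

definition mse_loss :: "nat \<Rightarrow> real mat \<Rightarrow> real vec \<Rightarrow> (nat \<Rightarrow> real mat) \<Rightarrow> real" where
  "mse_loss L X y \<Theta> =
     1 / real (dim_row X) * (euclid_norm (X *\<^sub>v end_to_end L \<Theta> - y))\<^sup>2"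

subsection \<open>Gradient flow\<close>

text \<open>Entry \<open>(a, b)\<close> of the gradient with respect to \<open>\<Theta> j\<close> is the partial derivative
  with respect to that entry, all other weights being kept fixed.\<close>

definition weight_gradient ::
    "((nat \<Rightarrow> real mat) \<Rightarrow> real) \<Rightarrow> (nat \<Rightarrow> real mat) \<Rightarrow> nat \<Rightarrow> real mat" where
  "weight_gradient loss \<Theta> j = mat (dim_row (\<Theta> j)) (dim_col (\<Theta> j))
     (\<lambda>(a, b). deriv (\<lambda>s. loss (\<Theta>(j := update_mat (\<Theta> j) (a, b) s))) (\<Theta> j $$ (a, b)))"

definition gradient_flow ::
    "nat \<Rightarrow> (nat \<Rightarrow> nat) \<Rightarrow> ((nat \<Rightarrow> real mat) \<Rightarrow> real) \<Rightarrow> (real \<Rightarrow> nat \<Rightarrow> real mat) \<Rightarrow> bool" where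
  "gradient_flow L w loss \<Theta> \<longleftrightarrow>
     (\<forall>t\<ge>0. is_weights L w (\<Theta> t) \<and>
        (\<forall>j\<in>{1..L}. \<forall>a<w (j - 1). \<forall>b<w j.
           ((\<lambda>s. \<Theta> s j $$ (a, b)) has_real_derivative - weight_gradient loss (\<Theta> t) j $$ (a, b))
             (at t within {0..})))"

subsection \<open>Pretraining followed by fine-tuning\<close>

text \<open>\<open>\<Theta>0\<close> is the result of pretraining, from 0-balanced weights, on some source data set
  labelled by the teacher \<open>\<theta>S\<close>. Gradient flow in general attains its result only as
  \<open>t \<rightarrow> \<infinity>\<close>. This includes pretraining that fits the teacher exactly at a finite
  time, because the gradient vanishes from then on.\<close>

definition pretrained ::
    "nat \<Rightarrow> nat \<Rightarrow> (nat \<Rightarrow> nat) \<Rightarrow> real vec \<Rightarrow> (nat \<Rightarrow> real mat) \<Rightarrow> bool" where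
  "pretrained d L w \<theta>S \<Theta>0 \<longleftrightarrow>
     (\<exists>nS XS \<Phi>. 0 < nS \<and> XS \<in> carrier_mat nS d \<and>
        zero_balanced L (\<Phi> 0) \<and>
        gradient_flow L w (mse_loss L XS (XS *\<^sub>v \<theta>S)) \<Phi> \<and>
        (\<forall>j\<in>{1..L}. mat_tendsto (\<lambda>t. \<Phi> t j) (\<Theta>0 j) at_top))"

text \<open>\<open>\<Theta>\<close> is the fine-tuning trajectory of a depth-\<open>L\<close> network whose pretraining learnt
  the source teacher perfectly and whose fine-tuning loss tends to zero.\<close>

definition fine_tuning ::
    "nat \<Rightarrow> real mat \<Rightarrow> real vec \<Rightarrow> real vec \<Rightarrow> nat \<Rightarrow> (nat \<Rightarrow> nat) \<Rightarrow> (real \<Rightarrow> nat \<Rightarrow> real mat) \<Rightarrow> bool"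
  where
  "fine_tuning d X \<theta>S \<theta>T L w \<Theta> \<longleftrightarrow>
     architecture d L w \<and>
     pretrained d L w \<theta>S (\<Theta> 0) \<and>
     end_to_end L (\<Theta> 0) = \<theta>S \<and>
     gradient_flow L w (mse_loss L X (X *\<^sub>v \<theta>T)) \<Theta> \<and>
     ((\<lambda>t. mse_loss L X (X *\<^sub>v \<theta>T) (\<Theta> t)) \<longlongrightarrow> 0) at_top"

end

theory Submission
  imports Defs
begin

text \<open>
  Balancedness \<open>W\<^sub>j\<^sup>T W\<^sub>j = W\<^sub>j\<^sub>+\<^sub>1 W\<^sub>j\<^sub>+\<^sub>1\<^sup>T\<close> is conserved by gradient flow and survives the limit
  ending the pretraining. Starting from the column \<open>W\<^sub>L\<close> with \<open>s = \<parallel>W\<^sub>L\<parallel>\<^sup>2\<close>, it makes every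
  \<open>A = W\<^sub>j W\<^sub>j\<^sup>T\<close> satisfy \<open>A\<^sup>2 = s A\<close>, whence \<open>\<beta> \<beta>\<^sup>T = s\<^sup>L\<^sup>-\<^sup>1 W\<^sub>1 W\<^sub>1\<^sup>T\<close> and \<open>\<parallel>\<beta>\<parallel>\<^sup>2 = s\<^sup>L\<close>.
  The loss gradient in \<open>\<beta>\<close> lies in the row space of \<open>X\<close>, so \<open>P\<^sub>\<bottom> W\<^sub>1\<close> does not move during
  fine-tuning. Hence the squares of the entries of \<open>P\<^sub>\<bottom> \<beta>\<close> are proportional to \<open>s\<^sup>L\<^sup>-\<^sup>1\<close>, and
  their signs are constant by continuity: \<open>P\<^sub>\<bottom> \<beta>(t) = (s(t) / s(0))\<^bsup>(L-1)/2\<^esup> P\<^sub>\<bottom> \<theta>\<^sub>S\<close>.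
  With \<open>\<kappa> = \<parallel>P\<^sub>\<bottom> \<theta>\<^sub>S\<parallel>\<^sup>2 / s(0)\<^sup>L\<^sup>-\<^sup>1\<close>, Pythagoras reads
  \<open>s\<^sup>L\<^sup>-\<^sup>1 (s - \<kappa>) = \<parallel>P\<^sub>\<parallel> \<beta>\<parallel>\<^sup>2\<close>, whose right-hand side converges to \<open>\<parallel>P\<^sub>\<parallel> \<theta>\<^sub>T\<parallel>\<^sup>2\<close>; the left-hand
  side is strictly increasing in \<open>s \<ge> \<kappa>\<close>, so \<open>s\<close> and with it \<open>\<beta>\<close> converges.
  For \<open>L \<rightarrow> \<infinity>\<close>, the squared norm ratio \<open>z\<close> of the limit solves
  \<open>\<parallel>\<theta>\<^sub>S\<parallel>\<^sup>2 z = \<parallel>P\<^sub>\<parallel> \<theta>\<^sub>T\<parallel>\<^sup>2 + \<parallel>P\<^sub>\<bottom> \<theta>\<^sub>S\<parallel>\<^sup>2 z\<^bsup>1-1/L\<^esup>\<close>, and \<open>z - z\<^sup>2/L \<le> z\<^bsup>1-1/L\<^esup> \<le> z + 1/L\<close>.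
\<close>

unbundle no vec_syntax

section \<open>Matrices and Euclidean norms\<close>

text \<open>The premises compare dimensions instead of fixing carrier sets. With no size left as a
  free variable, this law and the next three serve as rewrite rules for products of any
  shape.\<close>

lemma mat_mult_assoc:
  fixes A B C :: "'a::semiring_0 mat"
  assumes "dim_col A = dim_row B" "dim_col B = dim_row C"
  shows "A * B * C = A * (B * C)"
  by (rule assoc_mult_mat[of A "dim_row A" "dim_row B" B "dim_row C" C "dim_col C"]) (use assms in \<open>auto intro!: carrier_matI\<close>)

lemma mat_transpose_mult:
  fixes A B :: "'a::comm_semiring_0 mat"
  assumes "dim_col A = dim_row B"
  shows "transpose_mat (A * B) = transpose_mat B * transpose_mat A"
  by (rule transpose_mult[of A "dim_row A" "dim_row B" B "dim_col B"]) (use assms in \<open>auto intro!: carrier_matI\<close>)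

lemma mat_smult_mult_left:
  fixes A B :: "'a::comm_semiring_0 mat"
  assumes "dim_col A = dim_row B"
  shows "(c \<cdot>\<^sub>m A) * B = c \<cdot>\<^sub>m (A * B)"
  by (rule mult_smult_assoc_mat[of A "dim_row A" "dim_row B" B "dim_col B" c]) (use assms in \<open>auto intro!: carrier_matI\<close>)

lemma mat_smult_mult_right:
  fixes A B :: "'a::comm_semiring_0 mat"
  assumes "dim_col A = dim_row B"
  shows "A * (c \<cdot>\<^sub>m B) = c \<cdot>\<^sub>m (A * B)"
  by (rule mult_smult_distrib[of A "dim_row A" "dim_row B" B "dim_col B" c]) (use assms in \<open>auto intro!: carrier_matI\<close>)

lemma smult_smult_mat: "c \<cdot>\<^sub>m (k \<cdot>\<^sub>m A) = (c * k) \<cdot>\<^sub>m (A :: 'a::semigroup_mult mat)"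
  by (auto simp: mult.assoc)

lemma one_smult_mat: "1 \<cdot>\<^sub>m (A :: 'a::monoid_mult mat) = A"
  by auto

lemma zero_smult_mat: "0 \<cdot>\<^sub>m (A :: 'a::mult_zero mat) = 0\<^sub>m (dim_row A) (dim_col A)"
  by auto

lemma index_mult_sum:
  assumes "i < dim_row A" "j < dim_col B" "dim_col A = dim_row B"
  shows "(A * B) $$ (i, j) = (\<Sum>k<dim_row B. A $$ (i, k) * B $$ (k, j))"
  using assms by (auto simp: scalar_prod_def atLeast0LessThan intro!: sum.cong)

lemma gram_diag:
  fixes A :: "real mat"
  assumes "i < dim_row A"
  shows "(A * transpose_mat A) $$ (i, i) = (\<Sum>k<dim_col A. (A $$ (i, k))\<^sup>2)"
  using assms by (simp add: index_mult_sum power2_eq_square del: index_mult_mat(1))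

text \<open>The diagonal entries of the Gram matrix are the sums of squares of the rows.\<close>

lemma gram_zero_imp_zero:
  fixes A :: "real mat"
  assumes "A * transpose_mat A = 0\<^sub>m (dim_row A) (dim_row A)"
  shows "A = 0\<^sub>m (dim_row A) (dim_col A)"
proof (rule eq_matI)
  fix i j assume ij: "i < dim_row (0\<^sub>m (dim_row A) (dim_col A))" "j < dim_col (0\<^sub>m (dim_row A) (dim_col A))"
  have "(\<Sum>k<dim_col A. (A $$ (i, k))\<^sup>2) = 0"
    using gram_diag[of i A] assms ij by simp
  then have "\<forall>k<dim_col A. A $$ (i, k) = 0"
    by (subst (asm) sum_nonneg_eq_0_iff) auto
  then show "A $$ (i, j) = 0\<^sub>m (dim_row A) (dim_col A) $$ (i, j)"
    using ij by simp
qed auto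

text \<open>\<open>W B - s W\<close> vanishes because its Gram matrix is \<open>B\<^sup>3 - 2 s B\<^sup>2 + s\<^sup>2 B\<close>.\<close>

lemma gram_scaled_projection:
  fixes W B :: "real mat"
  assumes gram: "transpose_mat W * W = B" and idem: "B * B = s \<cdot>\<^sub>m B"
  shows "W * transpose_mat W * W = s \<cdot>\<^sub>m W"
proof -
  \<comment> \<open>Transposed so that \<open>N * transpose_mat N\<close> contains \<open>W\<close>
    only through \<open>transpose_mat W * W = B\<close>.\<close>
  define N where "N = transpose_mat (W * B - s \<cdot>\<^sub>m W)"
  have dB: "dim_row B = dim_col W" "dim_col B = dim_col W"
    using gram by auto
  have BT: "transpose_mat B = B"
    unfolding gram[symmetric] by (simp add: mat_transpose_mult)
  have NE: "N = B * transpose_mat W - s \<cdot>\<^sub>m transpose_mat W"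
    unfolding N_def using BT dB
    by (subst transpose_minus[of _ "dim_row W" "dim_col W"])
       (auto simp: mat_transpose_mult intro!: eq_matI carrier_matI)
  have "N * transpose_mat N =
     (B * transpose_mat W - s \<cdot>\<^sub>m transpose_mat W) * (W * B - s \<cdot>\<^sub>m W)"
    by (metis N_def NE transpose_transpose)
  also have "\<dots> = (B * transpose_mat W - s \<cdot>\<^sub>m transpose_mat W) * (W * B)
      - (B * transpose_mat W - s \<cdot>\<^sub>m transpose_mat W) * (s \<cdot>\<^sub>m W)"
    by (rule mult_minus_distrib_mat[of _ "dim_col W" "dim_row W" _ "dim_col W"]) (use dB in auto)
  also have "(B * transpose_mat W - s \<cdot>\<^sub>m transpose_mat W) * (W * B) =
      B * transpose_mat W * (W * B) - (s \<cdot>\<^sub>m transpose_mat W) * (W * B)"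
    by (rule minus_mult_distrib_mat[of _ "dim_col W" "dim_row W" _ _ "dim_col W"]) (use dB in auto)
  also have "(B * transpose_mat W - s \<cdot>\<^sub>m transpose_mat W) * (s \<cdot>\<^sub>m W) =
      B * transpose_mat W * (s \<cdot>\<^sub>m W) - (s \<cdot>\<^sub>m transpose_mat W) * (s \<cdot>\<^sub>m W)"
    by (rule minus_mult_distrib_mat[of _ "dim_col W" "dim_row W" _ _ "dim_col W"]) (use dB in auto)
  also have "B * transpose_mat W * (W * B) = (s * s) \<cdot>\<^sub>m B"
  proof -
    have "B * transpose_mat W * (W * B) = B * ((transpose_mat W * W) * B)"
      using dB by (simp add: mat_mult_assoc)
    also have "\<dots> = B * (s \<cdot>\<^sub>m B)"
      by (simp add: gram idem)
    also have "\<dots> = (s * s) \<cdot>\<^sub>m B"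
      using dB by (simp add: mat_smult_mult_right idem smult_smult_mat)
    finally show ?thesis .
  qed
  also have "(s \<cdot>\<^sub>m transpose_mat W) * (W * B) = (s * s) \<cdot>\<^sub>m B"
  proof -
    have "(s \<cdot>\<^sub>m transpose_mat W) * (W * B) = s \<cdot>\<^sub>m ((transpose_mat W * W) * B)"
      using dB by (simp add: mat_mult_assoc mat_smult_mult_left)
    then show ?thesis by (simp add: gram idem smult_smult_mat)
  qed
  also have "B * transpose_mat W * (s \<cdot>\<^sub>m W) = (s * s) \<cdot>\<^sub>m B"
  proof -
    have "B * transpose_mat W * (s \<cdot>\<^sub>m W) = s \<cdot>\<^sub>m (B * (transpose_mat W * W))"
      using dB by (simp add: mat_mult_assoc mat_smult_mult_right)
    then show ?thesis by (simp add: gram idem smult_smult_mat)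
  qed
  also have "(s \<cdot>\<^sub>m transpose_mat W) * (s \<cdot>\<^sub>m W) = (s * s) \<cdot>\<^sub>m B"
    by (simp add: mat_smult_mult_left mat_smult_mult_right gram smult_smult_mat)
  \<comment> \<open>All four products equal \<open>s * s\<close> times \<open>B\<close> and enter
    with the signs +, -, -, +.\<close>
  finally have "N * transpose_mat N = 0\<^sub>m (dim_row N) (dim_row N)"
    using dB by (auto simp: NE)
  from gram_zero_imp_zero[OF this] have N0: "N = 0\<^sub>m (dim_col W) (dim_row W)"
    using dB by (simp add: NE)
  have z: "W * B - s \<cdot>\<^sub>m W = 0\<^sub>m (dim_row W) (dim_col W)"
    using arg_cong[OF N0, of transpose_mat] by (simp add: N_def)
  have "W * B = s \<cdot>\<^sub>m W"
  proof (rule eq_matI)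
    fix i j assume "i < dim_row (s \<cdot>\<^sub>m W)" "j < dim_col (s \<cdot>\<^sub>m W)"
    then show "(W * B) $$ (i, j) = (s \<cdot>\<^sub>m W) $$ (i, j)"
      using arg_cong[OF z, of "\<lambda>M. M $$ (i, j)"] dB by (simp del: index_mult_mat(1))
  qed (use dB in auto)
  then show ?thesis
    using gram by (simp add: mat_mult_assoc)
qed

text \<open>A product is affine in each single entry of a factor; the slope is the product of the
  entries that meet it from the left and from the right. All partial derivatives of the loss come
  from this slope.\<close>

lemma index_mult_update_mat:
  fixes A U T :: "'a::comm_ring_1 mat"
  assumes "a < dim_row U" "b < dim_col U" "r < dim_row A" "0 < dim_col T"
    and "dim_col A = dim_row U" "dim_col U = dim_row T"
  shows "(A * (update_mat U (a, b) s * T)) $$ (r, 0)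
    = (A * (U * T)) $$ (r, 0) + (s - U $$ (a, b)) * (A $$ (r, a) * T $$ (b, 0))"
proof -
  have upd: "(update_mat U (a, b) s * T) $$ (i, 0)
      = (U * T) $$ (i, 0) + (if i = a then (s - U $$ (a, b)) * T $$ (b, 0) else 0)"
    if "i < dim_row U" for i
  proof -
    have "(update_mat U (a, b) s * T) $$ (i, 0)
        = (\<Sum>k<dim_row T. update_mat U (a, b) s $$ (i, k) * T $$ (k, 0))"
      using that assms by (subst index_mult_sum) auto
    also have "\<dots> = (\<Sum>k<dim_row T. U $$ (i, k) * T $$ (k, 0)
        + (if k = b then (if i = a then (s - U $$ (a, b)) * T $$ (b, 0) else 0) else 0))"
      using that assms by (intro sum.cong) (auto simp: update_mat_def algebra_simps)
    also have "\<dots> = (U * T) $$ (i, 0) + (if i = a then (s - U $$ (a, b)) * T $$ (b, 0) else 0)"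
      using that assms by (simp add: sum.distrib index_mult_sum del: index_mult_mat(1))
    finally show ?thesis .
  qed
  have "(A * (update_mat U (a, b) s * T)) $$ (r, 0)
      = (\<Sum>i<dim_row U. A $$ (r, i) * (update_mat U (a, b) s * T) $$ (i, 0))"
    using assms by (subst index_mult_sum) auto
  also have "\<dots> = (\<Sum>i<dim_row U. A $$ (r, i) * (U * T) $$ (i, 0)
      + (if i = a then (s - U $$ (a, b)) * (A $$ (r, a) * T $$ (b, 0)) else 0))"
    by (intro sum.cong) (auto simp: upd algebra_simps simp del: index_mult_mat(1))
  also have "\<dots> = (A * (U * T)) $$ (r, 0) + (s - U $$ (a, b)) * (A $$ (r, a) * T $$ (b, 0))"
    using assms by (simp add: sum.distrib index_mult_sum[of r A 0 "U * T"] del: index_mult_mat(1))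
  finally show ?thesis .
qed

lemma euclid_norm_sq: "(euclid_norm v)\<^sup>2 = (\<Sum>i<dim_vec v. (v $ i)\<^sup>2)"
  by (simp add: euclid_norm_def scalar_prod_def sum_nonneg power2_eq_square atLeast0LessThan)

lemma euclid_norm_nonneg: "0 \<le> euclid_norm v"
  unfolding euclid_norm_def scalar_prod_def by (simp add: sum_nonneg)

lemma euclid_norm_eq_0_iff: "euclid_norm v = 0 \<longleftrightarrow> v = 0\<^sub>v (dim_vec v)"
proof -
  have "euclid_norm v = 0 \<longleftrightarrow> (euclid_norm v)\<^sup>2 = 0" by simp
  also have "\<dots> \<longleftrightarrow> (\<forall>i<dim_vec v. v $ i = 0)"
    unfolding euclid_norm_sq by (subst sum_nonneg_eq_0_iff) auto
  also have "\<dots> \<longleftrightarrow> v = 0\<^sub>v (dim_vec v)"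
    by (metis eq_vecI index_zero_vec)
  finally show ?thesis .
qed

section \<open>Balanced linear networks\<close>

text \<open>\<open>suffix_prod L \<Theta> k\<close> is \<open>W\<^sub>k\<^sub>+\<^sub>1 \<cdots> W\<^sub>L\<close> and \<open>prefix_prod d \<Theta> k\<close> is \<open>W\<^sub>1 \<cdots> W\<^sub>k\<close>; layer indices
  start at 1, so layer \<open>Suc k\<close> has \<open>w k\<close> rows.\<close>

definition suffix_prod :: "nat \<Rightarrow> (nat \<Rightarrow> real mat) \<Rightarrow> nat \<Rightarrow> real mat" where
  "suffix_prod L \<Theta> k = foldr (*) (map \<Theta> [Suc k..<Suc L]) (1\<^sub>m 1)"

primrec prefix_prod :: "nat \<Rightarrow> (nat \<Rightarrow> real mat) \<Rightarrow> nat \<Rightarrow> real mat" where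
  "prefix_prod d \<Theta> 0 = 1\<^sub>m d"
| "prefix_prod d \<Theta> (Suc k) = prefix_prod d \<Theta> k * \<Theta> (Suc k)"

lemma suffix_prod_last: "suffix_prod L \<Theta> L = 1\<^sub>m 1"
  by (simp add: suffix_prod_def)

lemma suffix_prod_rec: "k < L \<Longrightarrow> suffix_prod L \<Theta> k = \<Theta> (Suc k) * suffix_prod L \<Theta> (Suc k)"
  unfolding suffix_prod_def by (subst upt_conv_Cons) auto

lemma end_to_end_suffix: "end_to_end L \<Theta> = col (suffix_prod L \<Theta> 0) 0"
  by (simp add: end_to_end_def suffix_prod_def)

lemma suffix_prod_upd: "i \<le> k \<Longrightarrow> suffix_prod L (\<Theta>(i := A)) k = suffix_prod L \<Theta> k"
  unfolding suffix_prod_def by (intro arg_cong2[of _ _ _ _ "\<lambda>xs. foldr (*) xs"] map_cong) auto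

lemma prefix_prod_upd: "k < i \<Longrightarrow> prefix_prod d (\<Theta>(i := A)) k = prefix_prod d \<Theta> k"
  by (induction k) auto

locale linear_network =
  fixes d L :: nat and w :: "nat \<Rightarrow> nat" and \<Theta> :: "nat \<Rightarrow> real mat"
  assumes depth: "1 \<le> L" and width_in: "w 0 = d" and width_out: "w L = 1"
    and weights: "is_weights L w \<Theta>"
begin

lemma dim_weight [simp]:
  assumes "k < L"
  shows "dim_row (\<Theta> (Suc k)) = w k" "dim_col (\<Theta> (Suc k)) = w (Suc k)"
  using weights assms unfolding is_weights_def by force+

lemma dim_suffix_prod [simp]:
  assumes "k \<le> L"
  shows "dim_row (suffix_prod L \<Theta> k) = w k" "dim_col (suffix_prod L \<Theta> k) = 1"
proof -
  have "dim_row (suffix_prod L \<Theta> k) = w k \<and> dim_col (suffix_prod L \<Theta> k) = 1"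
    using assms by (induction k rule: inc_induct)
      (auto simp: suffix_prod_last suffix_prod_rec width_out)
  then show "dim_row (suffix_prod L \<Theta> k) = w k" "dim_col (suffix_prod L \<Theta> k) = 1" by auto
qed

lemma dim_prefix_prod [simp]:
  assumes "k \<le> L"
  shows "dim_row (prefix_prod d \<Theta> k) = d" "dim_col (prefix_prod d \<Theta> k) = w k"
proof -
  have "dim_row (prefix_prod d \<Theta> k) = d \<and> dim_col (prefix_prod d \<Theta> k) = w k"
    using assms by (induction k) (auto simp: width_in)
  then show "dim_row (prefix_prod d \<Theta> k) = d" "dim_col (prefix_prod d \<Theta> k) = w k" by auto
qed

lemma prefix_mult_suffix:
  assumes "k \<le> L"
  shows "prefix_prod d \<Theta> k * suffix_prod L \<Theta> k = suffix_prod L \<Theta> 0"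
  using assms
proof (induction k)
  case (Suc k)
  then have "prefix_prod d \<Theta> (Suc k) * suffix_prod L \<Theta> (Suc k)
      = prefix_prod d \<Theta> k * (\<Theta> (Suc k) * suffix_prod L \<Theta> (Suc k))"
    by (simp add: mat_mult_assoc)
  then show ?case
    using Suc by (simp add: suffix_prod_rec)
qed (simp add: width_in)

lemma dim_end_to_end [simp]: "dim_vec (end_to_end L \<Theta>) = d"
  by (simp add: end_to_end_suffix width_in)

end

section \<open>Gram matrices of balanced layers\<close>

locale balanced_network = linear_network +
  assumes balanced: "zero_balanced L \<Theta>"
begin

text \<open>The \<open>s\<close> of the overview; the last layer is a column because
  \<open>w L = 1\<close>. By \<open>gram_idem\<close> this is the only nonzero eigenvalue that any
  \<open>gram k\<close> can have.\<close>

definition out_sq :: real where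
  "out_sq = (\<Sum>i<w (L - 1). (\<Theta> L $$ (i, 0))\<^sup>2)"

abbreviation gram :: "nat \<Rightarrow> real mat" where
  "gram k \<equiv> \<Theta> (Suc k) * transpose_mat (\<Theta> (Suc k))"

lemma out_sq_nonneg: "0 \<le> out_sq"
  by (simp add: out_sq_def sum_nonneg)

lemma balanced_step:
  assumes "Suc k < L"
  shows "transpose_mat (\<Theta> (Suc k)) * \<Theta> (Suc k) = gram (Suc k)"
  using balanced assms unfolding zero_balanced_def by (auto dest: spec[of _ "Suc k"])

lemma last_gram: "transpose_mat (\<Theta> L) * \<Theta> L = out_sq \<cdot>\<^sub>m 1\<^sub>m 1"
proof -
  have [simp]: "dim_row (\<Theta> L) = w (L - Suc 0)" "dim_col (\<Theta> L) = 1"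
    using dim_weight[of "L - 1"] depth width_out by auto
  show ?thesis
    by (rule eq_matI)
      (auto simp: out_sq_def index_mult_sum power2_eq_square simp del: index_mult_mat(1))
qed

text \<open>Downward induction from the last layer, whose inner Gram matrix is the scalar
  \<open>out_sq\<close>. The equation for layer \<open>Suc (Suc k)\<close> makes
  \<open>gram (Suc k)\<close> square to \<open>out_sq\<close> times itself. Balancedness identifies
  that matrix with the inner Gram matrix of layer \<open>Suc k\<close>, so
  \<open>gram_scaled_projection\<close> applies.\<close>

lemma cube_weight:
  assumes "k < L"
  shows "gram k * \<Theta> (Suc k) = out_sq \<cdot>\<^sub>m \<Theta> (Suc k)"
proof -
  from assms have "k \<le> L - 1" by simp
  then show ?thesis
  proof (induction k rule: inc_induct)
    case base
    have [simp]: "Suc (L - 1) = L" "Suc (L - Suc 0) = L" using depth by auto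
    have d: "dim_col (\<Theta> L) = 1"
      using dim_weight(2)[of "L - 1"] depth width_out by simp
    have "gram (L - 1) * \<Theta> (Suc (L - 1)) = \<Theta> L * (out_sq \<cdot>\<^sub>m 1\<^sub>m 1)"
      by (simp add: mat_mult_assoc last_gram)
    then show ?case
      using d by (simp add: mat_smult_mult_right)
  next
    case (step k)
    then have k: "Suc k < L" by simp
    have "gram (Suc k) * gram (Suc k) = (gram (Suc k) * \<Theta> (Suc (Suc k))) * transpose_mat (\<Theta> (Suc (Suc k)))"
      using k by (simp add: mat_mult_assoc)
    also have "\<dots> = out_sq \<cdot>\<^sub>m gram (Suc k)"
      using k by (simp add: step.IH mat_smult_mult_left)
    finally show ?case
      using gram_scaled_projection[OF balanced_step[OF k]] by simp
  qed
qed

lemma gram_idem: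
  assumes "k < L"
  shows "gram k * gram k = out_sq \<cdot>\<^sub>m gram k"
proof -
  have "gram k * gram k = (gram k * \<Theta> (Suc k)) * transpose_mat (\<Theta> (Suc k))"
    using assms by (simp add: mat_mult_assoc)
  then show ?thesis
    using assms by (simp add: cube_weight mat_smult_mult_left)
qed

text \<open>One more layer \<open>W\<close> wraps the induction hypothesis into \<open>W\<close> and
  its transpose. Balancedness turns the inner \<open>gram (Suc k)\<close> into
  \<open>transpose_mat W * W\<close>, the whole becomes the square of \<open>gram k\<close>, and
  \<open>gram_idem\<close> releases one more factor \<open>out_sq\<close>.\<close>

lemma suffix_outer:
  assumes "k < L"
  shows "suffix_prod L \<Theta> k * transpose_mat (suffix_prod L \<Theta> k) = out_sq ^ (L - Suc k) \<cdot>\<^sub>m gram k"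
proof -
  from assms have "k \<le> L - 1" by simp
  then show ?thesis
  proof (induction k rule: inc_induct)
    case base
    have d: "dim_col (\<Theta> L) = 1"
      using dim_weight(2)[of "L - 1"] depth width_out by simp
    show ?case
      using depth suffix_prod_rec[of "L - 1" L] d by (simp add: suffix_prod_last one_smult_mat)
  next
    case (step k)
    then have k: "Suc k < L" by simp
    let ?T = "suffix_prod L \<Theta> (Suc k)" and ?W = "\<Theta> (Suc k)"
    have "suffix_prod L \<Theta> k * transpose_mat (suffix_prod L \<Theta> k) = ?W * (?T * transpose_mat ?T) * transpose_mat ?W"
      using k by (simp add: suffix_prod_rec mat_mult_assoc mat_transpose_mult)
    also have "\<dots> = out_sq ^ (L - Suc (Suc k)) \<cdot>\<^sub>m (?W * (transpose_mat ?W * ?W) * transpose_mat ?W)"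
      unfolding balanced_step[OF k] step.IH using k by (simp add: mat_smult_mult_left mat_smult_mult_right)
    also have "?W * (transpose_mat ?W * ?W) * transpose_mat ?W = gram k * gram k"
      using k by (simp add: mat_mult_assoc)
    also have "out_sq ^ (L - Suc (Suc k)) \<cdot>\<^sub>m (gram k * gram k) = out_sq ^ (L - Suc k) \<cdot>\<^sub>m gram k"
      using k gram_idem[of k] by (simp add: smult_smult_mat power_Suc2[symmetric] Suc_diff_Suc del: power_Suc)
    finally show ?case .
  qed
qed

text \<open>The suffix after layer \<open>Suc k\<close> begins with the next layer, so by
  \<open>cube_weight\<close> the matrix \<open>gram (Suc k)\<close> multiplies it by
  \<open>out_sq\<close>. Hence each prepended layer multiplies the squared norm by
  \<open>out_sq\<close>.\<close>

lemma suffix_inner: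
  assumes "k < L"
  shows "transpose_mat (suffix_prod L \<Theta> k) * suffix_prod L \<Theta> k = out_sq ^ (L - k) \<cdot>\<^sub>m 1\<^sub>m 1"
proof -
  from assms have "k \<le> L - 1" by simp
  then show ?thesis
  proof (induction k rule: inc_induct)
    case base
    have d: "dim_col (\<Theta> L) = 1"
      using dim_weight(2)[of "L - 1"] depth width_out by simp
    show ?case
      using depth suffix_prod_rec[of "L - 1" L] d last_gram by (simp add: suffix_prod_last)
  next
    case (step k)
    then have k: "Suc k < L" by simp
    let ?T = "suffix_prod L \<Theta> (Suc k)" and ?W = "\<Theta> (Suc k)"
    have "gram (Suc k) * ?T = (gram (Suc k) * \<Theta> (Suc (Suc k))) * suffix_prod L \<Theta> (Suc (Suc k))"
      using k by (simp add: suffix_prod_rec[of "Suc k"] mat_mult_assoc)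
    also have "\<dots> = out_sq \<cdot>\<^sub>m ?T"
      using k by (simp add: cube_weight suffix_prod_rec[of "Suc k"] mat_smult_mult_left)
    finally have eig: "gram (Suc k) * ?T = out_sq \<cdot>\<^sub>m ?T" .
    have "transpose_mat (suffix_prod L \<Theta> k) * suffix_prod L \<Theta> k
        = transpose_mat ?T * ((transpose_mat ?W * ?W) * ?T)"
      using k by (simp add: suffix_prod_rec[of k] mat_mult_assoc mat_transpose_mult)
    also have "\<dots> = out_sq \<cdot>\<^sub>m (transpose_mat ?T * ?T)"
      unfolding balanced_step[OF k] eig using k by (simp add: mat_smult_mult_right)
    also have "\<dots> = out_sq ^ (L - k) \<cdot>\<^sub>m 1\<^sub>m 1"
      unfolding step.IH using k by (simp add: smult_smult_mat Suc_diff_Suc flip: power_Suc)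
    finally show ?case .
  qed
qed

lemma norm_end_to_end: "(euclid_norm (end_to_end L \<Theta>))\<^sup>2 = out_sq ^ L"
proof -
  have "scalar_prod (end_to_end L \<Theta>) (end_to_end L \<Theta>)
      = (transpose_mat (suffix_prod L \<Theta> 0) * suffix_prod L \<Theta> 0) $$ (0, 0)"
    by (simp add: end_to_end_suffix)
  also have "\<dots> = out_sq ^ L"
    using suffix_inner[of 0] depth by simp
  finally show ?thesis
    using out_sq_nonneg by (simp add: euclid_norm_def)
qed

text \<open>The diagonal of \<open>suffix_outer\<close> for \<open>k = 0\<close>, multiplied by
  \<open>Q\<close> from the left and by its transpose from the right. Only squares of entries are
  obtained this way; signs are settled in \<open>perp_scaling\<close>.\<close>

lemma first_layer_image:
  assumes "dim_col Q = d" "i < dim_row Q"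
  shows "((Q *\<^sub>v end_to_end L \<Theta>) $ i)\<^sup>2 = out_sq ^ (L - 1) * (\<Sum>b<w 1. ((Q * \<Theta> 1) $$ (i, b))\<^sup>2)"
proof -
  let ?T = "suffix_prod L \<Theta> 0"
  have L: "0 < L" using depth by simp
  have [simp]: "dim_row (\<Theta> (Suc 0)) = d" "dim_col (\<Theta> (Suc 0)) = w (Suc 0)" "dim_row ?T = d" "dim_col ?T = 1"
    using dim_weight[OF L] width_in by auto
  have "((Q *\<^sub>v end_to_end L \<Theta>) $ i)\<^sup>2 = (\<Sum>k<dim_col (Q * ?T). ((Q * ?T) $$ (i, k))\<^sup>2)"
    using assms by (simp add: end_to_end_suffix)
  also have "\<dots> = ((Q * ?T) * transpose_mat (Q * ?T)) $$ (i, i)"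
    using assms by (subst gram_diag) auto
  also have "(Q * ?T) * transpose_mat (Q * ?T) = Q * (?T * transpose_mat ?T) * transpose_mat Q"
    using assms by (simp add: mat_mult_assoc mat_transpose_mult)
  also have "\<dots> = out_sq ^ (L - 1) \<cdot>\<^sub>m ((Q * \<Theta> 1) * transpose_mat (Q * \<Theta> 1))"
    using suffix_outer[OF L] assms
    by (simp add: mat_smult_mult_left mat_smult_mult_right mat_mult_assoc mat_transpose_mult)
  also have "\<dots> $$ (i, i) = out_sq ^ (L - 1) * ((Q * \<Theta> 1) * transpose_mat (Q * \<Theta> 1)) $$ (i, i)"
    using assms by simp
  also have "((Q * \<Theta> 1) * transpose_mat (Q * \<Theta> 1)) $$ (i, i) = (\<Sum>b<w 1. ((Q * \<Theta> 1) $$ (i, b))\<^sup>2)"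
    using assms by (subst gram_diag) auto
  finally show ?thesis .
qed

text \<open>For \<open>out_sq = 0\<close> the symmetric matrix \<open>gram 0\<close> squares to
  zero, and two applications of \<open>gram_zero_imp_zero\<close> remove first \<open>gram 0\<close>
  and then the layer itself.\<close>

lemma first_layer_zero:
  assumes "out_sq = 0" "dim_col Q = d"
  shows "Q * \<Theta> 1 = 0\<^sub>m (dim_row Q) (w 1)"
proof -
  have L: "0 < L" using depth by simp
  have [simp]: "dim_row (\<Theta> (Suc 0)) = d" "dim_col (\<Theta> (Suc 0)) = w (Suc 0)"
    using dim_weight[OF L] width_in by auto
  have "gram 0 * transpose_mat (gram 0) = 0\<^sub>m (dim_row (gram 0)) (dim_row (gram 0))"
    using gram_idem[OF L] assms by (simp add: mat_transpose_mult zero_smult_mat)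
  then have "gram 0 = 0\<^sub>m d d"
    using gram_zero_imp_zero[of "gram 0"] by simp
  then have "\<Theta> 1 = 0\<^sub>m d (w 1)"
    using gram_zero_imp_zero[of "\<Theta> 1"] by simp
  then show ?thesis using assms by simp
qed

end

section \<open>Gradient of the loss\<close>

text \<open>The loss has gradient \<open>transpose_mat X * scaled_residual X y \<beta>\<close> with
  respect to \<beta>. The residual is a column matrix so that weight gradients become plain matrix
  products.\<close>

definition scaled_residual :: "real mat \<Rightarrow> real vec \<Rightarrow> real vec \<Rightarrow> real mat" where
  "scaled_residual X y \<beta> = mat (dim_row X) 1 (\<lambda>(r, _). 2 / real (dim_row X) * (X *\<^sub>v \<beta> - y) $ r)"

lemma dim_scaled_residual [simp]:
  "dim_row (scaled_residual X y \<beta>) = dim_row X" "dim_col (scaled_residual X y \<beta>) = 1"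
  by (auto simp: scaled_residual_def)

context linear_network
begin

lemma mult_end_to_end:
  assumes "dim_col X = d" "r < dim_row X" "k \<le> L"
  shows "(X *\<^sub>v end_to_end L \<Theta>) $ r = ((X * prefix_prod d \<Theta> k) * suffix_prod L \<Theta> k) $$ (r, 0)"
proof -
  have "(X *\<^sub>v end_to_end L \<Theta>) $ r = (X * suffix_prod L \<Theta> 0) $$ (r, 0)"
    using assms by (simp add: end_to_end_suffix)
  then show ?thesis
    using assms by (simp add: mat_mult_assoc prefix_mult_suffix del: index_mult_mat(1))
qed

text \<open>Each prediction is affine in a single weight entry, so the loss is a polynomial of
  degree at most two in \<open>s\<close> and can be differentiated directly.\<close>

lemma mse_loss_update:
  assumes "dim_col X = d" "dim_vec y = dim_row X" "k < L" "a < w k" "b < w (Suc k)"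
  shows "mse_loss L X y (\<Theta>(Suc k := update_mat (\<Theta> (Suc k)) (a, b) s))
    = 1 / real (dim_row X) * (\<Sum>r<dim_row X. ((X *\<^sub>v end_to_end L \<Theta> - y) $ r
        + (s - \<Theta> (Suc k) $$ (a, b))
          * ((X * prefix_prod d \<Theta> k) $$ (r, a) * suffix_prod L \<Theta> (Suc k) $$ (b, 0)))\<^sup>2)"
proof -
  let ?U = "update_mat (\<Theta> (Suc k)) (a, b) s"
  let ?\<Theta> = "\<Theta>(Suc k := ?U)"
  interpret upd: linear_network d L w ?\<Theta>
  proof
    show "is_weights L w ?\<Theta>"
      using weights assms unfolding is_weights_def by (auto intro!: carrier_matI)
  qed (use depth width_in width_out in auto)
  have "(X *\<^sub>v end_to_end L ?\<Theta>) $ r = (X *\<^sub>v end_to_end L \<Theta>) $ r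
      + (s - \<Theta> (Suc k) $$ (a, b))
          * ((X * prefix_prod d \<Theta> k) $$ (r, a) * suffix_prod L \<Theta> (Suc k) $$ (b, 0))"
    if r: "r < dim_row X" for r
  proof -
    have "(X *\<^sub>v end_to_end L ?\<Theta>) $ r
        = ((X * prefix_prod d \<Theta> k) * (?U * suffix_prod L \<Theta> (Suc k))) $$ (r, 0)"
      \<comment> \<open>The prefix ends before the changed layer and the suffix starts after it, so
        both are those of the unchanged network.\<close>
      using upd.mult_end_to_end[OF assms(1) r, of k] assms
      by (simp add: suffix_prod_rec prefix_prod_upd suffix_prod_upd del: index_mult_mat(1))
    also have "\<dots> = ((X * prefix_prod d \<Theta> k) * (\<Theta> (Suc k) * suffix_prod L \<Theta> (Suc k))) $$ (r, 0)
       + (s - \<Theta> (Suc k) $$ (a, b))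
          * ((X * prefix_prod d \<Theta> k) $$ (r, a) * suffix_prod L \<Theta> (Suc k) $$ (b, 0))"
      using assms r by (intro index_mult_update_mat) auto
    also have "\<Theta> (Suc k) * suffix_prod L \<Theta> (Suc k) = suffix_prod L \<Theta> k"
      using assms by (simp add: suffix_prod_rec)
    also have "((X * prefix_prod d \<Theta> k) * suffix_prod L \<Theta> k) $$ (r, 0) = (X *\<^sub>v end_to_end L \<Theta>) $ r"
      using mult_end_to_end[OF assms(1) r, of k] assms by simp
    finally show ?thesis .
  qed
  then show ?thesis
    unfolding mse_loss_def euclid_norm_sq using assms
    by (intro arg_cong2[of _ _ _ _ "(*)"] sum.cong refl) (auto simp: diff_add_eq simp del: index_mult_mat index_mult_mat_vec)
qed

text \<open>The chain rule for prefix times layer times suffix, read off from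
  \<open>mse_loss_update\<close>. The bracketing displays the gradient in the end-to-end vector,
  which lies in the row space of \<open>X\<close>.\<close>

lemma weight_gradient_mse:
  assumes "dim_col X = d" "dim_vec y = dim_row X" "k < L"
  shows "weight_gradient (mse_loss L X y) \<Theta> (Suc k)
    = transpose_mat (prefix_prod d \<Theta> k)
      * (transpose_mat X * scaled_residual X y (end_to_end L \<Theta>))
      * transpose_mat (suffix_prod L \<Theta> (Suc k))" (is "?lhs = ?rhs")
proof (rule eq_matI)
  let ?R = "scaled_residual X y (end_to_end L \<Theta>)"
  let ?XP = "X * prefix_prod d \<Theta> k" and ?T = "suffix_prod L \<Theta> (Suc k)"
  fix a b assume "a < dim_row ?rhs" "b < dim_col ?rhs"
  then have ab: "a < w k" "b < w (Suc k)" using assms by auto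
  let ?res = "\<lambda>r. (X *\<^sub>v end_to_end L \<Theta> - y) $ r"
  have "((\<lambda>s. mse_loss L X y (\<Theta>(Suc k := update_mat (\<Theta> (Suc k)) (a, b) s)))
      has_real_derivative 1 / real (dim_row X) * (\<Sum>r<dim_row X. 2 * ?res r * (?XP $$ (r, a) * ?T $$ (b, 0))))
      (at (\<Theta> (Suc k) $$ (a, b)))"
    unfolding mse_loss_update[OF assms ab]
    by (rule DERIV_cmult) (auto intro!: derivative_eq_intros sum.cong simp del: index_mult_mat index_mult_mat_vec index_minus_vec)
  then have "?lhs $$ (a, b)
      = 1 / real (dim_row X) * (\<Sum>r<dim_row X. 2 * ?res r * (?XP $$ (r, a) * ?T $$ (b, 0)))"
    unfolding weight_gradient_def using ab assms by (simp add: DERIV_imp_deriv del: index_mult_mat(1))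
  also have "\<dots> = (\<Sum>r<dim_row X. ?XP $$ (r, a) * ?R $$ (r, 0)) * ?T $$ (b, 0)"
    unfolding sum_distrib_left sum_distrib_right
    by (intro sum.cong) (auto simp: scaled_residual_def simp del: index_mult_mat index_mult_mat_vec index_minus_vec)
  also have "(\<Sum>r<dim_row X. ?XP $$ (r, a) * ?R $$ (r, 0)) = (transpose_mat ?XP * ?R) $$ (a, 0)"
    using ab assms by (subst index_mult_sum) auto
  also have "transpose_mat ?XP * ?R = transpose_mat (prefix_prod d \<Theta> k) * (transpose_mat X * ?R)"
    using assms by (simp add: mat_transpose_mult mat_mult_assoc)
  also have "(\<dots>) $$ (a, 0) * ?T $$ (b, 0) = ?rhs $$ (a, b)"
    using ab assms by (subst (2) index_mult_sum) auto
  finally show "?lhs $$ (a, b) = ?rhs $$ (a, b)" .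
qed (use assms in \<open>auto simp: weight_gradient_def\<close>)

end

section \<open>Conservation laws of gradient flow\<close>

lemma constant_of_zero_derivative:
  fixes f :: "real \<Rightarrow> real"
  assumes "\<And>t. 0 \<le> t \<Longrightarrow> (f has_real_derivative 0) (at t within {0..})" and "0 \<le> t"
  shows "f t = f 0"
proof -
  obtain c where "\<And>x. x \<in> {0..} \<Longrightarrow> f x = c"
    using has_field_derivative_zero_constant[of "{0::real..}" f] assms(1) by auto
  then show ?thesis using assms(2) by simp
qed

text \<open>Covers both phases: it is interpreted with the source data for pretraining and with
  \<open>X\<close> for fine-tuning.\<close>

locale mse_flow =
  fixes d L :: nat and w :: "nat \<Rightarrow> nat" and X :: "real mat" and y :: "real vec"
    and \<Theta> :: "real \<Rightarrow> nat \<Rightarrow> real mat"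
  assumes depth: "1 \<le> L" and width_in: "w 0 = d" and width_out: "w L = 1"
    and dim_X: "dim_col X = d" and dim_y: "dim_vec y = dim_row X"
    and flow: "gradient_flow L w (mse_loss L X y) \<Theta>"
begin

lemma network: "0 \<le> t \<Longrightarrow> linear_network d L w (\<Theta> t)"
  using flow depth width_in width_out unfolding gradient_flow_def linear_network_def by auto

definition grad :: "real \<Rightarrow> nat \<Rightarrow> real mat" where
  "grad t k = transpose_mat (prefix_prod d (\<Theta> t) k)
      * (transpose_mat X * scaled_residual X y (end_to_end L (\<Theta> t)))
      * transpose_mat (suffix_prod L (\<Theta> t) (Suc k))"

lemma dim_grad [simp]:
  assumes "0 \<le> t" "k < L"
  shows "dim_row (grad t k) = w k" "dim_col (grad t k) = w (Suc k)"
proof -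
  interpret net: linear_network d L w "\<Theta> t" using network[OF assms(1)] .
  show "dim_row (grad t k) = w k" "dim_col (grad t k) = w (Suc k)"
    using assms by (auto simp: grad_def)
qed

lemma dim_weight [simp]:
  assumes "0 \<le> t" "k < L"
  shows "dim_row (\<Theta> t (Suc k)) = w k" "dim_col (\<Theta> t (Suc k)) = w (Suc k)"
  using linear_network.dim_weight[OF network[OF assms(1)] assms(2)] by auto

lemma weight_derivative:
  assumes "0 \<le> t" "k < L" "a < w k" "b < w (Suc k)"
  shows "((\<lambda>s. \<Theta> s (Suc k) $$ (a, b)) has_real_derivative - grad t k $$ (a, b)) (at t within {0..})"
proof -
  have "weight_gradient (mse_loss L X y) (\<Theta> t) (Suc k) = grad t k"
    unfolding grad_def by (rule linear_network.weight_gradient_mse[OF network]) (use assms dim_X dim_y in auto)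
  moreover have "Suc k \<in> {1..L}" using assms by auto
  ultimately show ?thesis
    using flow assms unfolding gradient_flow_def by (metis diff_Suc_1)
qed

text \<open>Both sides are the gradient in the end-to-end vector between the transposed prefix and
  the transposed suffix that meet between the two layers. This common value is what conserves the
  balance.\<close>

lemma grad_weight:
  assumes "0 \<le> t" "Suc k < L"
  shows "grad t (Suc k) * transpose_mat (\<Theta> t (Suc (Suc k))) = transpose_mat (\<Theta> t (Suc k)) * grad t k"
proof -
  interpret net: linear_network d L w "\<Theta> t" using network[OF assms(1)] .
  show ?thesis
    using assms dim_X
    by (simp add: grad_def suffix_prod_rec[of "Suc k"] mat_transpose_mult mat_mult_assoc)
qed

text \<open>The derivatives of the two Gram matrices are, up to the same sign, the two sides of
  \<open>grad_weight\<close> plus their transposes, so they cancel.\<close>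

lemma balance_conserved:
  assumes t: "0 \<le> t" and k: "Suc k < L" and i: "i < w (Suc k)" and j: "j < w (Suc k)"
  shows "(transpose_mat (\<Theta> t (Suc k)) * \<Theta> t (Suc k)
      - \<Theta> t (Suc (Suc k)) * transpose_mat (\<Theta> t (Suc (Suc k)))) $$ (i, j)
    = (transpose_mat (\<Theta> 0 (Suc k)) * \<Theta> 0 (Suc k)
      - \<Theta> 0 (Suc (Suc k)) * transpose_mat (\<Theta> 0 (Suc (Suc k)))) $$ (i, j)"
proof -
  let ?V = "\<lambda>t. \<Theta> t (Suc k)" and ?W = "\<lambda>t. \<Theta> t (Suc (Suc k))"
  \<comment> \<open>Explicit sums replace the matrix entries because the sizes of the weights are
    known only for \<open>t \<ge> 0\<close>.\<close>
  define D where "D t = (\<Sum>a<w k. ?V t $$ (a, i) * ?V t $$ (a, j))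
    - (\<Sum>c<w (Suc (Suc k)). ?W t $$ (i, c) * ?W t $$ (j, c))" for t
  have D: "(transpose_mat (?V t) * ?V t - ?W t * transpose_mat (?W t)) $$ (i, j) = D t"
    if "0 \<le> t" for t
    using that k i j by (simp add: index_mult_sum D_def del: index_mult_mat(1))
  have "(D has_real_derivative 0) (at t within {0..})" if t: "0 \<le> t" for t
  proof -
    have cross: "(\<Sum>c<w (Suc (Suc k)). grad t (Suc k) $$ (i, c) * ?W t $$ (j, c))
        = (\<Sum>a<w k. ?V t $$ (a, i) * grad t k $$ (a, j))"
      if i: "i < w (Suc k)" and j: "j < w (Suc k)" for i j
      using arg_cong[OF grad_weight[OF t k], of "\<lambda>M. M $$ (i, j)"] t k i j
      by (simp add: index_mult_sum del: index_mult_mat(1))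
    have "(D has_real_derivative
        (\<Sum>a<w k. - grad t k $$ (a, i) * ?V t $$ (a, j) + - grad t k $$ (a, j) * ?V t $$ (a, i))
        - (\<Sum>c<w (Suc (Suc k)). - grad t (Suc k) $$ (i, c) * ?W t $$ (j, c)
            + - grad t (Suc k) $$ (j, c) * ?W t $$ (i, c))) (at t within {0..})"
      unfolding D_def
      by (intro DERIV_diff DERIV_sum DERIV_mult weight_derivative) (use t k i j in auto)
    moreover have "(\<Sum>a<w k. - grad t k $$ (a, i) * ?V t $$ (a, j) + - grad t k $$ (a, j) * ?V t $$ (a, i))
        - (\<Sum>c<w (Suc (Suc k)). - grad t (Suc k) $$ (i, c) * ?W t $$ (j, c)
            + - grad t (Suc k) $$ (j, c) * ?W t $$ (i, c)) = 0"
      using cross[OF i j] cross[OF j i] by (simp add: sum_subtractf sum_negf mult.commute)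
    ultimately show ?thesis by simp
  qed
  from constant_of_zero_derivative[OF this t] show ?thesis
    using D[OF t] D[of 0] by simp
qed

lemma zero_balanced_iff:
  assumes "0 \<le> t"
  shows "zero_balanced L (\<Theta> t) \<longleftrightarrow> (\<forall>k. Suc k < L \<longrightarrow> (\<forall>i<w (Suc k). \<forall>j<w (Suc k).
    (transpose_mat (\<Theta> t (Suc k)) * \<Theta> t (Suc k)
      - \<Theta> t (Suc (Suc k)) * transpose_mat (\<Theta> t (Suc (Suc k)))) $$ (i, j) = 0))"
    (is "_ \<longleftrightarrow> ?R")
proof
  assume b: "zero_balanced L (\<Theta> t)"
  then show ?R
    using assms unfolding zero_balanced_def by (auto dest!: spec[of _ "Suc _"])
next
  assume R: ?R
  show "zero_balanced L (\<Theta> t)"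
    unfolding zero_balanced_def
  proof (intro allI impI)
    fix j assume "1 \<le> j \<and> j \<le> L - 1"
    then obtain k where k: "j = Suc k" "Suc k < L" by (cases j) auto
    show "transpose_mat (\<Theta> t j) * \<Theta> t j = \<Theta> t (j + 1) * transpose_mat (\<Theta> t (j + 1))"
      using R k assms by (intro eq_matI) (auto simp del: index_mult_mat(1))
  qed
qed

lemma zero_balanced_preserved:
  assumes "zero_balanced L (\<Theta> 0)" "0 \<le> t"
  shows "zero_balanced L (\<Theta> t)"
  using assms zero_balanced_iff[of t] zero_balanced_iff[of 0] balance_conserved by auto

text \<open>Balancedness is a closed condition: entries of both Gram matrices are polynomials in the
  weights and agree at all times \<open>t \<ge> 0\<close>, and limits are unique.\<close>

lemma zero_balanced_limit:
  assumes bal: "zero_balanced L (\<Theta> 0)"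
    and lim: "\<And>j. j \<in> {1..L} \<Longrightarrow> mat_tendsto (\<lambda>t. \<Theta> t j) (\<Psi> j) at_top"
    and net: "linear_network d L w \<Psi>"
  shows "zero_balanced L \<Psi>"
  unfolding zero_balanced_def
proof (intro allI impI)
  interpret lim: linear_network d L w \<Psi> using net .
  fix j assume "1 \<le> j \<and> j \<le> L - 1"
  then obtain k where k: "j = Suc k" "Suc k < L" by (cases j) auto
  have ent: "((\<lambda>t. \<Theta> t (Suc l) $$ (a, b)) \<longlongrightarrow> \<Psi> (Suc l) $$ (a, b)) at_top"
    if "l < L" "a < w l" "b < w (Suc l)" for l a b
    using lim[of "Suc l"] that unfolding mat_tendsto_def by auto
  show "transpose_mat (\<Psi> j) * \<Psi> j = \<Psi> (j + 1) * transpose_mat (\<Psi> (j + 1))"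
  proof (rule eq_matI)
    fix a b assume "a < dim_row (\<Psi> (j + 1) * transpose_mat (\<Psi> (j + 1)))"
      "b < dim_col (\<Psi> (j + 1) * transpose_mat (\<Psi> (j + 1)))"
    then have ab: "a < w (Suc k)" "b < w (Suc k)" using k by auto
    have V: "((\<lambda>t. \<Sum>c<w k. \<Theta> t (Suc k) $$ (c, a) * \<Theta> t (Suc k) $$ (c, b)) \<longlongrightarrow>
        (\<Sum>c<w k. \<Psi> (Suc k) $$ (c, a) * \<Psi> (Suc k) $$ (c, b))) at_top"
      by (intro tendsto_sum tendsto_mult ent) (use k ab in auto)
    have W: "((\<lambda>t. \<Sum>c<w (Suc (Suc k)). \<Theta> t (Suc (Suc k)) $$ (a, c) * \<Theta> t (Suc (Suc k)) $$ (b, c)) \<longlongrightarrow>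
        (\<Sum>c<w (Suc (Suc k)). \<Psi> (Suc (Suc k)) $$ (a, c) * \<Psi> (Suc (Suc k)) $$ (b, c))) at_top"
      by (intro tendsto_sum tendsto_mult ent) (use k ab in auto)
    have "\<forall>\<^sub>F t in at_top. (\<Sum>c<w k. \<Theta> t (Suc k) $$ (c, a) * \<Theta> t (Suc k) $$ (c, b))
        = (\<Sum>c<w (Suc (Suc k)). \<Theta> t (Suc (Suc k)) $$ (a, c) * \<Theta> t (Suc (Suc k)) $$ (b, c))"
      using eventually_ge_at_top[of 0]
    proof eventually_elim
      case (elim t)
      have "(transpose_mat (\<Theta> t (Suc k)) * \<Theta> t (Suc k)
          - \<Theta> t (Suc (Suc k)) * transpose_mat (\<Theta> t (Suc (Suc k)))) $$ (a, b) = 0"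
        using zero_balanced_preserved[OF bal elim] zero_balanced_iff[OF elim] k ab by blast
      then show ?case
        using elim k ab by (simp add: index_mult_sum del: index_mult_mat(1))
    qed
    from tendsto_unique[OF _ W Lim_transform_eventually[OF V this]]
    have "(\<Sum>c<w (Suc (Suc k)). \<Psi> (Suc (Suc k)) $$ (a, c) * \<Psi> (Suc (Suc k)) $$ (b, c))
        = (\<Sum>c<w k. \<Psi> (Suc k) $$ (c, a) * \<Psi> (Suc k) $$ (c, b))"
      by simp
    then show "(transpose_mat (\<Psi> j) * \<Psi> j) $$ (a, b) = (\<Psi> (j + 1) * transpose_mat (\<Psi> (j + 1))) $$ (a, b)"
      using k ab by (simp add: index_mult_sum del: index_mult_mat(1))
  qed (use k in auto)
qed

text \<open>The prefix before the first layer is the identity, so its gradient starts with the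
  factor \<open>transpose_mat X\<close>, which \<open>Q\<close> annihilates.\<close>

lemma first_layer_conserved:
  assumes Q: "dim_col Q = d" "Q * transpose_mat X = 0\<^sub>m (dim_row Q) (dim_row X)"
    and t: "0 \<le> t" and i: "i < dim_row Q" and b: "b < w 1"
  shows "(Q * \<Theta> t 1) $$ (i, b) = (Q * \<Theta> 0 1) $$ (i, b)"
proof -
  have L: "0 < L" using depth by simp
  define f where "f t = (\<Sum>a<d. Q $$ (i, a) * \<Theta> t 1 $$ (a, b))" for t
  have f: "(Q * \<Theta> t 1) $$ (i, b) = f t" if "0 \<le> t" for t
    using that L Q i b dim_weight[OF that L] width_in by (simp add: f_def index_mult_sum del: index_mult_mat(1))
  have "(f has_real_derivative 0) (at t within {0..})" if t: "0 \<le> t" for t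
  proof -
    interpret net: linear_network d L w "\<Theta> t" using network[OF t] .
    have "Q * grad t 0 = (Q * transpose_mat X)
        * (scaled_residual X y (end_to_end L (\<Theta> t)) * transpose_mat (suffix_prod L (\<Theta> t) 1))"
      using L Q(1) dim_X by (simp add: grad_def mat_mult_assoc width_in)
    also have "\<dots> = 0\<^sub>m (dim_row Q) (w 1)"
      unfolding Q(2) using L by simp
    finally have "(Q * grad t 0) $$ (i, b) = 0" using i b by simp
    then have "(\<Sum>a<d. Q $$ (i, a) * - grad t 0 $$ (a, b)) = 0"
      using t L Q i b width_in by (simp add: index_mult_sum sum_negf del: index_mult_mat(1))
    moreover have "(f has_real_derivative (\<Sum>a<d. Q $$ (i, a) * - grad t 0 $$ (a, b))) (at t within {0..})"
      unfolding f_def using weight_derivative[OF t L] b width_in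
      by (intro DERIV_sum DERIV_cmult) auto
    ultimately show ?thesis by simp
  qed
  from constant_of_zero_derivative[OF this t] show ?thesis
    using f[OF t] f[of 0] by simp
qed

text \<open>Continuity serves the sign argument in \<open>perp_scaling\<close>.\<close>

lemma continuous_suffix_prod:
  assumes "k \<le> L" "i < w k"
  shows "continuous_on {0..} (\<lambda>t. suffix_prod L (\<Theta> t) k $$ (i, 0))"
  using assms
proof (induction k arbitrary: i rule: inc_induct)
  case base
  then show ?case by (simp add: suffix_prod_last width_out)
next
  case (step k)
  have "continuous_on {0..} (\<lambda>t. \<Theta> t (Suc k) $$ (i, b))" if "b < w (Suc k)" for b
    unfolding continuous_on_eq_continuous_within
    using weight_derivative[of _ k i b] step.hyps step.prems that by (auto intro: DERIV_continuous)
  then have "continuous_on {0..} (\<lambda>t. \<Sum>b<w (Suc k). \<Theta> t (Suc k) $$ (i, b) * suffix_prod L (\<Theta> t) (Suc k) $$ (b, 0))"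
    using step by (intro continuous_intros) auto
  moreover have "suffix_prod L (\<Theta> t) k $$ (i, 0)
      = (\<Sum>b<w (Suc k). \<Theta> t (Suc k) $$ (i, b) * suffix_prod L (\<Theta> t) (Suc k) $$ (b, 0))"
    if "t \<in> {0..}" for t
  proof -
    from that have t: "0 \<le> t" by simp
    interpret net: linear_network d L w "\<Theta> t" using network[OF t] .
    show ?thesis
      using step.hyps step.prems by (simp add: suffix_prod_rec index_mult_sum del: index_mult_mat(1))
  qed
  ultimately show ?case
    by (subst continuous_on_cong[OF refl]) auto
qed

lemma continuous_image_end_to_end:
  assumes "dim_col Q = d" "i < dim_row Q"
  shows "continuous_on {0..} (\<lambda>t. (Q *\<^sub>v end_to_end L (\<Theta> t)) $ i)"
proof -
  have "continuous_on {0..} (\<lambda>t. \<Sum>k<d. Q $$ (i, k) * suffix_prod L (\<Theta> t) 0 $$ (k, 0))"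
    using width_in by (intro continuous_intros continuous_suffix_prod) auto
  moreover have "(Q *\<^sub>v end_to_end L (\<Theta> t)) $ i = (\<Sum>k<d. Q $$ (i, k) * suffix_prod L (\<Theta> t) 0 $$ (k, 0))"
    if "t \<in> {0..}" for t
  proof -
    from that have t: "0 \<le> t" by simp
    interpret net: linear_network d L w "\<Theta> t" using network[OF t] .
    show ?thesis
      using assms width_in by (simp add: end_to_end_suffix scalar_prod_def atLeast0LessThan)
  qed
  ultimately show ?thesis
    by (subst continuous_on_cong[OF refl]) auto
qed

end

section \<open>Trajectories that start balanced\<close>

locale balanced_flow = mse_flow +
  assumes balanced: "zero_balanced L (\<Theta> 0)"
begin

lemma balanced_net: "0 \<le> t \<Longrightarrow> balanced_network d L w (\<Theta> t)"
  using network zero_balanced_preserved[OF balanced]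
  by (auto intro: balanced_network.intro balanced_network_axioms.intro)

abbreviation strength :: "real \<Rightarrow> real" where
  "strength t \<equiv> balanced_network.out_sq L w (\<Theta> t)"

lemma image_end_to_end_sq:
  assumes Q: "dim_col Q = d" "Q * transpose_mat X = 0\<^sub>m (dim_row Q) (dim_row X)"
    and t: "0 \<le> t" and i: "i < dim_row Q"
  shows "((Q *\<^sub>v end_to_end L (\<Theta> t)) $ i)\<^sup>2
    = strength t ^ (L - 1) * (\<Sum>b<w 1. ((Q * \<Theta> 0 1) $$ (i, b))\<^sup>2)"
  using balanced_network.first_layer_image[OF balanced_net[OF t] Q(1) i]
    first_layer_conserved[OF Q t i] by simp

text \<open>If the strength vanished at time \<open>t\<close>, so would
  \<open>Q * \<Theta> t 1\<close>. That matrix is conserved, hence it would vanish at time 0 too,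
  and with it the entry assumed nonzero.\<close>

lemma strength_pos:
  assumes Q: "dim_col Q = d" "Q * transpose_mat X = 0\<^sub>m (dim_row Q) (dim_row X)"
    and t: "0 \<le> t" and i: "i < dim_row Q" and nz: "(Q *\<^sub>v end_to_end L (\<Theta> 0)) $ i \<noteq> 0"
  shows "0 < strength t"
proof (rule ccontr)
  assume "\<not> 0 < strength t"
  then have "strength t = 0"
    using balanced_network.out_sq_nonneg[OF balanced_net[OF t]] by simp
  from balanced_network.first_layer_zero[OF balanced_net[OF t] this Q(1)]
  have "(Q * \<Theta> 0 1) $$ (i, b) = 0" if "b < w 1" for b
    using first_layer_conserved[OF Q t i that] i that by simp
  then have "((Q *\<^sub>v end_to_end L (\<Theta> 0)) $ i)\<^sup>2 = 0"
    using image_end_to_end_sq[OF Q _ i, of 0] by simp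
  with nz show False by simp
qed

text \<open>\<open>image_end_to_end_sq\<close> fixes the absolute value. An entry that is nonzero at
  time 0 stays nonzero by \<open>strength_pos\<close>, hence keeps its sign by continuity.\<close>

lemma perp_scaling:
  assumes Q: "dim_col Q = d" "Q * transpose_mat X = 0\<^sub>m (dim_row Q) (dim_row X)"
    and t: "0 \<le> t" and i: "i < dim_row Q" and s0: "0 < strength 0"
  shows "(Q *\<^sub>v end_to_end L (\<Theta> t)) $ i
    = sqrt ((strength t / strength 0) ^ (L - 1)) * (Q *\<^sub>v end_to_end L (\<Theta> 0)) $ i"
proof -
  define f where "f t = (Q *\<^sub>v end_to_end L (\<Theta> t)) $ i" for t
  have sq: "(f t)\<^sup>2 = (strength t / strength 0) ^ (L - 1) * (f 0)\<^sup>2"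
    using image_end_to_end_sq[OF Q t i] image_end_to_end_sq[OF Q _ i, of 0] s0
    by (simp add: f_def power_divide del: index_mult_mat_vec)
  have "f t = sqrt ((strength t / strength 0) ^ (L - 1)) * f 0"
  proof (cases "f 0 = 0")
    case True
    then show ?thesis using sq by simp
  next
    case False
    have fnz: "f u \<noteq> 0" if "0 \<le> u" for u
    proof -
      have "(\<Sum>b<w 1. ((Q * \<Theta> 0 1) $$ (i, b))\<^sup>2) \<noteq> 0"
        using image_end_to_end_sq[OF Q _ i, of 0] False by (auto simp: f_def simp del: index_mult_mat_vec)
      moreover have "0 < strength u"
        using strength_pos[OF Q that i] False by (simp add: f_def del: index_mult_mat_vec)
      ultimately show ?thesis
        using image_end_to_end_sq[OF Q that i] by (auto simp: f_def simp del: index_mult_mat_vec)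
    qed
    \<comment> \<open>At time 0 the product is a square, so a value \<le> 0 at time \<open>t\<close>
      would force a zero in between.\<close>
    have "0 < f t * f 0"
    proof (rule ccontr)
      assume "\<not> 0 < f t * f 0"
      moreover have "continuous_on {0..t} (\<lambda>u. f u * f 0)"
        unfolding f_def by (intro continuous_intros continuous_on_subset[OF continuous_image_end_to_end[OF Q(1) i]]) auto
      ultimately obtain u where "0 \<le> u" "f u * f 0 = 0"
        using IVT2'[of "\<lambda>u. f u * f 0" t 0 0] t by auto
      then show False using fnz False by auto
    qed
    moreover have "\<bar>f t\<bar> = sqrt ((strength t / strength 0) ^ (L - 1)) * \<bar>f 0\<bar>"
      using arg_cong[OF sq, of sqrt] by (simp add: real_sqrt_mult)
    ultimately show ?thesis
      by (auto simp: zero_less_mult_iff)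
  qed
  then show ?thesis by (simp add: f_def del: index_mult_mat_vec)
qed

end

text \<open>Conservation along the pretraining flow, followed by passage to its limit.\<close>

lemma pretrained_zero_balanced:
  assumes "architecture d L w" "pretrained d L w \<theta>S \<Psi>" "is_weights L w \<Psi>"
  shows "zero_balanced L \<Psi>"
proof -
  obtain nS XS \<Phi> where P: "XS \<in> carrier_mat nS d" "zero_balanced L (\<Phi> 0)"
    "gradient_flow L w (mse_loss L XS (XS *\<^sub>v \<theta>S)) \<Phi>"
    "\<And>j. j \<in> {1..L} \<Longrightarrow> mat_tendsto (\<lambda>t. \<Phi> t j) (\<Psi> j) at_top"
    using assms(2) unfolding pretrained_def by blast
  interpret mse_flow d L w XS "XS *\<^sub>v \<theta>S" \<Phi>
    by unfold_locales (use assms(1) P in \<open>auto simp: architecture_def\<close>)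
  show ?thesis
    by (rule zero_balanced_limit[OF P(2,4)])
       (use assms depth width_in width_out in \<open>auto intro: linear_network.intro\<close>)
qed

section \<open>Projection onto the row space\<close>

locale full_row_rank =
  fixes n d :: nat and X :: "real mat"
  assumes X: "X \<in> carrier_mat n d" and inv: "invertible_mat (X * transpose_mat X)"
begin

lemma dim_X [simp]: "dim_row X = n" "dim_col X = d"
  using X by auto

text \<open>The Moore-Penrose inverse of \<open>X\<close>. Factoring \<open>P_par X\<close> through
  it shows that the projection of a vector depends only on its predictions.\<close>

definition right_inv :: "real mat" where
  "right_inv = transpose_mat X * the (mat_inverse (X * transpose_mat X))"

lemma P_par_factor: "P_par X = right_inv * X"
  by (simp add: P_par_def right_inv_def)

text \<open>Links the abstract \<open>invertible_mat\<close> to the computed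
  \<open>mat_inverse\<close>: a two-sided inverse makes the matrix a unit of
  \<open>ring_mat\<close>, and on units the computation succeeds.\<close>

lemma gram_inverse:
  obtains M where "mat_inverse (X * transpose_mat X) = Some M" "M \<in> carrier_mat n n"
    "(X * transpose_mat X) * M = 1\<^sub>m n" "M * (X * transpose_mat X) = 1\<^sub>m n"
proof -
  let ?S = "X * transpose_mat X"
  have S: "?S \<in> carrier_mat n n" by (auto intro: carrier_matI)
  obtain B where B: "?S * B = 1\<^sub>m n" "B * ?S = 1\<^sub>m (dim_row B)"
    using inv unfolding invertible_mat_def inverts_mat_def by auto
  \<comment> \<open>\<open>invertible_mat\<close> leaves the size of \<open>B\<close> open; the two
    equations determine it.\<close>
  have "dim_row B = n" "dim_col B = n"
    using arg_cong[OF B(1), of dim_col] arg_cong[OF B(2), of dim_col] by auto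
  then have "?S \<in> Units (ring_mat TYPE(real) n ())"
    using B S unfolding Units_def ring_mat_simps by (auto intro!: bexI[of _ B] carrier_matI)
  then obtain M where M: "mat_inverse ?S = Some M"
    using mat_inverse(1)[OF S, of "()"] by (cases "mat_inverse ?S") auto
  then show thesis
    using mat_inverse(2)[OF S M] that by auto
qed

lemma dim_right_inv [simp]: "dim_row right_inv = d" "dim_col right_inv = n"
proof -
  obtain M where "mat_inverse (X * transpose_mat X) = Some M" "M \<in> carrier_mat n n"
    using gram_inverse .
  then show "dim_row right_inv = d" "dim_col right_inv = n"
    by (auto simp: right_inv_def)
qed

lemma dim_P [simp]:
  "dim_row (P_par X) = d" "dim_col (P_par X) = d" "dim_row (P_perp X) = d" "dim_col (P_perp X) = d"
  by (auto simp: P_par_factor P_perp_def)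

lemma P_par_row_space: "P_par X * transpose_mat X = transpose_mat X"
proof -
  obtain M where M: "mat_inverse (X * transpose_mat X) = Some M" "M \<in> carrier_mat n n"
    "M * (X * transpose_mat X) = 1\<^sub>m n"
    using gram_inverse .
  have "P_par X * transpose_mat X = transpose_mat X * (M * (X * transpose_mat X))"
    using M(1,2) by (simp add: P_par_def mat_mult_assoc)
  then show ?thesis
    by (simp add: M(3))
qed

lemma P_perp_row_space: "P_perp X * transpose_mat X = 0\<^sub>m d n"
proof -
  have "P_perp X * transpose_mat X = 1\<^sub>m d * transpose_mat X - P_par X * transpose_mat X"
    unfolding P_perp_def dim_X
    by (rule minus_mult_distrib_mat[of _ d d _ _ n]) (auto intro: carrier_matI)
  then show ?thesis
    by (auto simp: P_par_row_space)
qed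

text \<open>The Gram matrix of the rows is symmetric, so the transpose of its inverse is again an
  inverse and equals it.\<close>

lemma P_par_transpose: "transpose_mat (P_par X) = P_par X"
proof -
  let ?S = "X * transpose_mat X"
  obtain M where M: "mat_inverse ?S = Some M" "M \<in> carrier_mat n n" "?S * M = 1\<^sub>m n"
    using gram_inverse .
  have MT: "transpose_mat M * ?S = 1\<^sub>m n"
    using arg_cong[OF M(3), of transpose_mat] M(2) by (simp add: mat_transpose_mult)
  have "transpose_mat M = transpose_mat M * (?S * M)"
    using M by simp
  also have "\<dots> = transpose_mat M * ?S * M"
    using M(2) by (simp add: mat_mult_assoc)
  finally have "transpose_mat M = M"
    unfolding MT using M(2) by simp
  then show ?thesis
    using M(1,2) by (simp add: P_par_def mat_transpose_mult mat_mult_assoc)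
qed

text \<open>By symmetry \<open>P_par X\<close> also starts with \<open>transpose_mat X\<close>,
  which \<open>P_perp X\<close> annihilates; transposing exchanges the two factors.\<close>

lemma P_par_perp: "P_par X * P_perp X = 0\<^sub>m d d"
proof -
  have "P_perp X * P_par X = 0\<^sub>m d d"
  proof -
    have "P_par X = transpose_mat X * transpose_mat right_inv"
      using P_par_transpose by (simp add: P_par_factor mat_transpose_mult)
    then have "P_perp X * P_par X = (P_perp X * transpose_mat X) * transpose_mat right_inv"
      by (simp add: mat_mult_assoc)
    then show ?thesis by (simp add: P_perp_row_space)
  qed
  moreover have "transpose_mat (P_perp X) = P_perp X"
    unfolding P_perp_def dim_X
    by (subst transpose_minus[of _ d d]) (auto simp: P_par_transpose intro: carrier_matI)
  moreover have "transpose_mat (P_perp X * P_par X) = P_par X * transpose_mat (P_perp X)"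
    by (simp add: mat_transpose_mult P_par_transpose)
  ultimately show ?thesis
    by simp
qed

lemma P_decomp:
  assumes "v \<in> carrier_vec d"
  shows "v = P_perp X *\<^sub>v v + P_par X *\<^sub>v v"
proof -
  have "P_perp X *\<^sub>v v = 1\<^sub>m d *\<^sub>v v - P_par X *\<^sub>v v"
    unfolding P_perp_def dim_X
    by (rule minus_mult_distrib_mat_vec[of _ d d]) (use assms in \<open>auto intro: carrier_matI\<close>)
  then show ?thesis
    using assms by (intro eq_vecI) auto
qed

text \<open>The cross term vanishes by moving the symmetric \<open>P_par X\<close> onto the
  perpendicular part. Separate vectors \<open>u\<close> and \<open>v\<close> allow a source part to
  be combined with a trajectory or target part.\<close>

lemma norm_pythagoras:
  assumes "u \<in> carrier_vec d" "v \<in> carrier_vec d"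
  shows "(euclid_norm (c \<cdot>\<^sub>v (P_perp X *\<^sub>v u) + P_par X *\<^sub>v v))\<^sup>2
    = c\<^sup>2 * (euclid_norm (P_perp X *\<^sub>v u))\<^sup>2 + (euclid_norm (P_par X *\<^sub>v v))\<^sup>2"
proof -
  let ?a = "P_perp X *\<^sub>v u" and ?b = "P_par X *\<^sub>v v"
  have "scalar_prod ?b ?a = scalar_prod (transpose_mat (P_par X) *\<^sub>v v) ?a"
    by (simp add: P_par_transpose)
  also have "\<dots> = scalar_prod v (P_par X *\<^sub>v ?a)"
    by (rule transpose_vec_mult_scalar[of _ d d]) (use assms in \<open>auto intro: carrier_matI carrier_vecI\<close>)
  also have "P_par X *\<^sub>v ?a = (P_par X * P_perp X) *\<^sub>v u"
    by (rule assoc_mult_mat_vec[of _ d d _ d, symmetric]) (use assms in \<open>auto intro: carrier_matI\<close>)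
  also have "\<dots> = 0\<^sub>v d"
    using assms by (auto simp: P_par_perp scalar_prod_def)
  finally have "(\<Sum>i<d. ?a $ i * ?b $ i) = 0"
    using assms by (simp add: scalar_prod_def atLeast0LessThan mult.commute del: index_mult_mat_vec)
  then have "(\<Sum>i<d. 2 * c * (?a $ i * ?b $ i)) = 0"
    by (simp flip: sum_distrib_left)
  moreover have "(\<Sum>i<d. (c * ?a $ i + ?b $ i)\<^sup>2)
      = (\<Sum>i<d. c\<^sup>2 * (?a $ i)\<^sup>2) + (\<Sum>i<d. (?b $ i)\<^sup>2) + (\<Sum>i<d. 2 * c * (?a $ i * ?b $ i))"
    unfolding sum.distrib[symmetric]
    by (intro sum.cong) (simp_all add: power2_eq_square algebra_simps del: index_mult_mat_vec)
  ultimately show ?thesis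
    by (simp add: euclid_norm_sq sum_distrib_left del: index_mult_mat_vec)
qed

end

section \<open>Limits of real functions\<close>

text \<open>A lower bound for the slope of \<open>x ^ m * (x - \<kappa>)\<close> on
  \<open>x \<ge> \<kappa>\<close>, which converts closeness of values into closeness of
  arguments.\<close>

lemma shifted_power_mono:
  fixes \<kappa> a b :: real
  assumes "0 \<le> \<kappa>" "\<kappa> \<le> a" "a \<le> b"
  shows "\<kappa> ^ m * (b - a) \<le> b ^ m * (b - \<kappa>) - a ^ m * (a - \<kappa>)"
proof -
  have "\<kappa> ^ m * (b - a) \<le> a ^ m * (b - a)"
    using assms by (intro mult_right_mono power_mono) auto
  moreover have "a ^ m * (b - \<kappa>) \<le> b ^ m * (b - \<kappa>)"
    using assms by (intro mult_right_mono power_mono) auto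
  ultimately show ?thesis by (simp add: algebra_simps)
qed

text \<open>The intermediate value theorem provides \<open>l\<close>; the slope bound then controls
  the distance of \<open>s\<close> from \<open>l\<close> by that of \<open>g\<close> from
  \<open>p\<close>.\<close>

lemma tendsto_of_shifted_power:
  fixes s g :: "real \<Rightarrow> real"
  assumes "0 < \<kappa>" and ev: "\<forall>\<^sub>F t in F. 0 < s t \<and> 0 \<le> g t \<and> s t ^ m * (s t - \<kappa>) = g t"
    and g: "(g \<longlongrightarrow> p) F" and "0 \<le> p"
  shows "\<exists>l\<ge>\<kappa>. l ^ m * (l - \<kappa>) = p \<and> (s \<longlongrightarrow> l) F"
proof -
  let ?h = "\<lambda>x. x ^ m * (x - \<kappa>)"
  \<comment> \<open>Chosen so that the slope bound alone already lifts the value at \<open>B\<close>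
    to at least \<open>p\<close>.\<close>
  define B where "B = \<kappa> + p / \<kappa> ^ m"
  have B: "\<kappa> \<le> B" using assms by (simp add: B_def)
  have "p = \<kappa> ^ m * (B - \<kappa>)" using assms by (simp add: B_def)
  also have "\<dots> \<le> ?h B" using shifted_power_mono[of \<kappa> \<kappa> B m] assms B by simp
  finally have "p \<le> ?h B" .
  moreover have "continuous_on {\<kappa>..B} ?h" by (intro continuous_intros)
  ultimately obtain l where l: "\<kappa> \<le> l" "?h l = p"
    using IVT'[of ?h \<kappa> p B] B assms by auto
  have "\<forall>\<^sub>F t in F. norm (s t - l) \<le> \<bar>g t - p\<bar> / \<kappa> ^ m"
    using ev
  proof eventually_elim
    case (elim t)
    then have "0 \<le> s t - \<kappa>"
      by (metis zero_le_mult_iff zero_less_power not_le)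
    then have ks: "\<kappa> \<le> s t" by simp
    have "\<kappa> ^ m * \<bar>s t - l\<bar> \<le> \<bar>g t - p\<bar>"
      using shifted_power_mono[of \<kappa> "s t" l m] shifted_power_mono[of \<kappa> l "s t" m] ks l elim assms(1)
      by (cases "s t \<le> l") auto
    then show ?case using assms(1) by (simp add: field_simps)
  qed
  moreover have "((\<lambda>t. \<bar>g t - p\<bar> / \<kappa> ^ m) \<longlongrightarrow> 0) F"
    using tendsto_divide[OF tendsto_rabs[OF tendsto_diff[OF g tendsto_const[of p]]] tendsto_const[of "\<kappa> ^ m"]] assms(1)
    by simp
  ultimately have "((\<lambda>t. s t - l) \<longlongrightarrow> 0) F"
    by (rule Lim_null_comparison)
  then show ?thesis using l LIM_zero_cancel by blast
qed

text \<open>The upper bound is Young's inequality for \<open>z\<close> and 1 with weights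
  \<open>1 - 1/L\<close> and \<open>1/L\<close>. The lower bound writes the power as
  \<open>z * exp (- ln z / L)\<close> and uses \<open>exp u \<ge> 1 + u\<close> and
  \<open>ln z < z\<close>.\<close>

lemma powr_root_bounds:
  fixes z :: real
  assumes "0 \<le> z" "1 \<le> L"
  shows "z powr ((real L - 1) / real L) \<le> z + 1 / real L"
    and "z - z\<^sup>2 / real L \<le> z powr ((real L - 1) / real L)"
proof -
  define \<alpha> where "\<alpha> = (real L - 1) / real L"
  have \<alpha>: "0 \<le> \<alpha>" "\<alpha> = 1 - 1 / real L" "\<alpha> \<le> 1"
    using assms by (auto simp: \<alpha>_def field_simps)
  show "z powr ((real L - 1) / real L) \<le> z + 1 / real L"
  \<comment> \<open>\<open>0 powr u\<close> is 0 for every \<open>u\<close>, also for the exponent 0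
    that arises at \<open>L = 1\<close>.\<close>
  proof (cases "z = 0")
    case False
    then have "z powr \<alpha> * 1 powr (1 / real L) \<le> \<alpha> * z + 1 / real L * 1"
      using assms \<alpha> by (intro Youngs_inequality_0) auto
    moreover have "\<alpha> * z \<le> z" using \<alpha> assms by (simp add: mult_left_le_one_le)
    ultimately show ?thesis by (simp add: \<alpha>_def)
  qed simp
  show "z - z\<^sup>2 / real L \<le> z powr ((real L - 1) / real L)"
  proof (cases "z = 0")
    case False
    then have z: "0 < z" using assms by simp
    have "1 - z / real L \<le> 1 + - (ln z / real L)"
      using ln_less_self[OF z] assms by (simp add: divide_right_mono)
    also have "\<dots> \<le> exp (- (ln z / real L))" by (rule exp_ge_add_one_self)
    finally have "z * (1 - z / real L) \<le> z * exp (- (ln z / real L))"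
      using z by simp
    also have "\<dots> = z powr \<alpha>"
      using z unfolding \<alpha>(2) powr_diff by (simp add: powr_def exp_minus field_simps)
    finally show ?thesis by (simp add: \<alpha>_def power2_eq_square algebra_simps)
  qed simp
qed

text \<open>In terms of the square \<open>z\<close> of \<open>x\<close>, replacing the power of
  \<open>z\<close> by \<open>z\<close> itself costs a term of order \<open>1/L\<close> once
  \<open>z\<close> is bounded. What remains says that \<open>r\<^sup>2 * z\<close> tends to
  \<open>p\<^sup>2\<close>; solving the equation for the coefficient gives its limit.\<close>

lemma infinite_depth_coefficient:
  fixes x :: "nat \<Rightarrow> real" and p q r :: real
  assumes "0 < q" "0 < r" "0 \<le> p"
    and x: "\<And>L. 1 \<le> L \<Longrightarrow> 0 \<le> x L"
    and eq: "\<And>L. 1 \<le> L \<Longrightarrow> (r\<^sup>2 + q\<^sup>2) * (x L)\<^sup>2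
        = p\<^sup>2 + (x L powr ((real L - 1) / real L))\<^sup>2 * q\<^sup>2"
  shows "(\<lambda>L. x L powr ((real L - 1) / real L)) \<longlonglongrightarrow> p / r"
proof -
  define z where "z L = (x L)\<^sup>2" for L
  \<comment> \<open>A bound on \<open>z L\<close> uniform in \<open>L\<close>, obtained below from
    the upper estimate alone.\<close>
  define M where "M = (p\<^sup>2 + q\<^sup>2) / r\<^sup>2"
  have zeq: "(r\<^sup>2 + q\<^sup>2) * z L = p\<^sup>2 + z L powr ((real L - 1) / real L) * q\<^sup>2"
    and sq: "(x L powr ((real L - 1) / real L))\<^sup>2 = z L powr ((real L - 1) / real L)"
    if "1 \<le> L" for L
  proof -
    show "(x L powr ((real L - 1) / real L))\<^sup>2 = z L powr ((real L - 1) / real L)"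
      using x[OF that] by (simp add: z_def power2_eq_square powr_mult)
    then show "(r\<^sup>2 + q\<^sup>2) * z L = p\<^sup>2 + z L powr ((real L - 1) / real L) * q\<^sup>2"
      using eq[OF that] by (simp add: z_def)
  qed
  have bound: "norm (r\<^sup>2 * z L - p\<^sup>2) \<le> (q\<^sup>2 * (1 + M\<^sup>2)) * inverse (real L)" if L: "1 \<le> L" for L
  proof -
    have z0: "0 \<le> z L" by (simp add: z_def)
    have "q\<^sup>2 * z L powr ((real L - 1) / real L) \<le> q\<^sup>2 * (z L + 1 / real L)"
      using powr_root_bounds(1)[OF z0 L] by (intro mult_left_mono) auto
    then have up: "r\<^sup>2 * z L - p\<^sup>2 \<le> q\<^sup>2 / real L"
      using zeq[OF L] by (simp add: algebra_simps)
    have "q\<^sup>2 / real L \<le> q\<^sup>2"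
      using L mult_left_mono[of 1 "real L" "q\<^sup>2"] by (simp add: divide_le_eq)
    then have "r\<^sup>2 * z L \<le> p\<^sup>2 + q\<^sup>2" using up by linarith
    then have "z L \<le> M"
      using assms(2) by (simp add: M_def field_simps)
    then have zM: "(z L)\<^sup>2 \<le> M\<^sup>2" using z0 by (simp add: power_mono)
    have "q\<^sup>2 * (z L - (z L)\<^sup>2 / real L) \<le> q\<^sup>2 * z L powr ((real L - 1) / real L)"
      using powr_root_bounds(2)[OF z0 L] by (intro mult_left_mono) auto
    then have "p\<^sup>2 - r\<^sup>2 * z L \<le> q\<^sup>2 * ((z L)\<^sup>2 / real L)"
      using zeq[OF L] by (simp add: algebra_simps)
    also have "\<dots> \<le> q\<^sup>2 * (M\<^sup>2 / real L)"
      using zM by (intro mult_left_mono divide_right_mono) auto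
    finally have low: "p\<^sup>2 - r\<^sup>2 * z L \<le> q\<^sup>2 * (M\<^sup>2 / real L)" .
    have "0 \<le> q\<^sup>2 * (M\<^sup>2 / real L)" "0 \<le> q\<^sup>2 / real L" by auto
    then have "\<bar>r\<^sup>2 * z L - p\<^sup>2\<bar> \<le> q\<^sup>2 / real L + q\<^sup>2 * (M\<^sup>2 / real L)"
      using up low by linarith
    then show ?thesis by (simp add: divide_inverse algebra_simps)
  qed
  have "(\<lambda>L. r\<^sup>2 * z L - p\<^sup>2) \<longlonglongrightarrow> 0"
  proof (rule Lim_null_comparison)
    show "\<forall>\<^sub>F L in sequentially. norm (r\<^sup>2 * z L - p\<^sup>2) \<le> (q\<^sup>2 * (1 + M\<^sup>2)) * inverse (real L)"
      using bound by (auto simp: eventually_sequentially)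
    show "(\<lambda>L. (q\<^sup>2 * (1 + M\<^sup>2)) * inverse (real L)) \<longlonglongrightarrow> 0"
      by (rule tendsto_mult_right_zero[OF lim_inverse_n])
  qed
  \<comment> \<open>The square of the coefficient, solved from \<open>zeq\<close> and written
    through the null sequence just found.\<close>
  then have "(\<lambda>L. ((r\<^sup>2 + q\<^sup>2) * ((r\<^sup>2 * z L - p\<^sup>2) + p\<^sup>2) / r\<^sup>2 - p\<^sup>2) / q\<^sup>2)
      \<longlonglongrightarrow> ((r\<^sup>2 + q\<^sup>2) * (0 + p\<^sup>2) / r\<^sup>2 - p\<^sup>2) / q\<^sup>2"
    by (intro tendsto_intros) (use assms in auto)
  also have "((r\<^sup>2 + q\<^sup>2) * (0 + p\<^sup>2) / r\<^sup>2 - p\<^sup>2) / q\<^sup>2 = (p / r)\<^sup>2"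
    using assms by (simp add: field_simps power2_eq_square)
  finally have "(\<lambda>L. sqrt (((r\<^sup>2 + q\<^sup>2) * ((r\<^sup>2 * z L - p\<^sup>2) + p\<^sup>2) / r\<^sup>2 - p\<^sup>2) / q\<^sup>2))
      \<longlonglongrightarrow> sqrt ((p / r)\<^sup>2)"
    by (rule tendsto_real_sqrt)
  moreover have "sqrt ((p / r)\<^sup>2) = p / r" using assms by simp
  moreover have "\<forall>\<^sub>F L in sequentially.
      sqrt (((r\<^sup>2 + q\<^sup>2) * ((r\<^sup>2 * z L - p\<^sup>2) + p\<^sup>2) / r\<^sup>2 - p\<^sup>2) / q\<^sup>2)
      = x L powr ((real L - 1) / real L)"
  proof (rule eventually_sequentiallyI[of 1])
    fix L :: nat assume L: "1 \<le> L"
    have "((r\<^sup>2 + q\<^sup>2) * ((r\<^sup>2 * z L - p\<^sup>2) + p\<^sup>2) / r\<^sup>2 - p\<^sup>2) / q\<^sup>2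
        = ((r\<^sup>2 + q\<^sup>2) * z L - p\<^sup>2) / q\<^sup>2"
      using assms by simp
    also have "\<dots> = (x L powr ((real L - 1) / real L))\<^sup>2"
      unfolding zeq[OF L] sq[OF L] using assms by simp
    finally show "sqrt (((r\<^sup>2 + q\<^sup>2) * ((r\<^sup>2 * z L - p\<^sup>2) + p\<^sup>2) / r\<^sup>2 - p\<^sup>2) / q\<^sup>2)
      = x L powr ((real L - 1) / real L)" by simp
  qed
  ultimately show ?thesis
    by (simp add: tendsto_cong)
qed

text \<open>Translates between the norm ratio \<open>x\<close> of the theorem and the ratio \<rho>
  of strengths: \<open>x\<close> is \<rho> to the power \<open>L/2\<close>, which the exponent
  lowers to \<open>(L-1)/2\<close>.\<close>

lemma powr_depth_exponent:
  fixes x \<rho> :: real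
  assumes "0 \<le> x" "0 < \<rho>" "x\<^sup>2 = \<rho> ^ L" "1 \<le> L"
  shows "x powr ((real L - 1) / real L) = sqrt (\<rho> ^ (L - 1))"
proof -
  have "x = sqrt (\<rho> ^ L)" using assms by (metis real_sqrt_unique)
  also have "\<dots> = \<rho> powr (real L / 2)"
    using assms by (simp add: powr_half_sqrt[symmetric] powr_realpow[symmetric] powr_powr)
  finally have x: "x = \<rho> powr (real L / 2)" .
  have "real L / 2 * ((real L - 1) / real L) = (real L - 1) / 2"
    using assms by simp
  then have "x powr ((real L - 1) / real L) = \<rho> powr ((real L - 1) / 2)"
    unfolding x powr_powr by (simp only:)
  also have "\<dots> = sqrt (\<rho> ^ (L - 1))"
    using assms by (simp add: powr_half_sqrt[symmetric] powr_realpow[symmetric] powr_powr of_nat_diff)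
  finally show ?thesis .
qed

section \<open>Fine-tuning\<close>

lemma mse_loss_tendsto_0:
  assumes "0 < dim_row X" "((\<lambda>t. mse_loss L X y (\<Theta> t)) \<longlongrightarrow> 0) F" "dim_vec y = dim_row X" "r < dim_row X"
  shows "((\<lambda>t. (X *\<^sub>v end_to_end L (\<Theta> t)) $ r) \<longlongrightarrow> y $ r) F"
proof -
  let ?e = "\<lambda>t. (X *\<^sub>v end_to_end L (\<Theta> t) - y) $ r"
  have "norm (?e t) \<le> sqrt (real (dim_row X) * mse_loss L X y (\<Theta> t))" for t
  proof -
    have "(?e t)\<^sup>2 \<le> (\<Sum>i<dim_row X. ((X *\<^sub>v end_to_end L (\<Theta> t) - y) $ i)\<^sup>2)"
      using assms by (intro member_le_sum) auto
    also have "\<dots> = real (dim_row X) * mse_loss L X y (\<Theta> t)"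
      using assms by (simp add: mse_loss_def euclid_norm_sq)
    finally show ?thesis by (metis real_norm_def real_sqrt_abs real_sqrt_le_mono)
  qed
  moreover have "((\<lambda>t. sqrt (real (dim_row X) * mse_loss L X y (\<Theta> t))) \<longlongrightarrow> sqrt (real (dim_row X) * 0)) F"
    by (intro tendsto_intros assms)
  ultimately have "(?e \<longlongrightarrow> 0) F"
    by (intro Lim_null_comparison[of ?e "\<lambda>t. sqrt (real (dim_row X) * mse_loss L X y (\<Theta> t))"]) auto
  then show ?thesis
    using assms(3,4) by (simp add: LIM_zero_iff del: index_mult_mat_vec)
qed

section \<open>Limits of fine-tuning at fixed and at infinite depth\<close>

context full_row_rank
begin

lemma P_par_tendsto:
  assumes lim: "\<And>r. r < n \<Longrightarrow> ((\<lambda>t. (X *\<^sub>v \<beta> t) $ r) \<longlongrightarrow> (X *\<^sub>v v) $ r) F"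
    and dims: "\<forall>\<^sub>F t in F. \<beta> t \<in> carrier_vec d" "v \<in> carrier_vec d" and i: "i < d"
  shows "((\<lambda>t. (P_par X *\<^sub>v \<beta> t) $ i) \<longlongrightarrow> (P_par X *\<^sub>v v) $ i) F"
proof -
  have entry: "(P_par X *\<^sub>v u) $ i = (\<Sum>r<n. right_inv $$ (i, r) * (X *\<^sub>v u) $ r)" if "u \<in> carrier_vec d" for u
  proof -
    have "P_par X *\<^sub>v u = right_inv *\<^sub>v (X *\<^sub>v u)"
      unfolding P_par_factor
      by (rule assoc_mult_mat_vec[of _ d n _ d]) (use that in \<open>auto intro: carrier_matI\<close>)
    then have "(P_par X *\<^sub>v u) $ i = scalar_prod (row right_inv i) (X *\<^sub>v u)"
      using i by simp
    then show ?thesis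
      using i by (simp add: scalar_prod_def[of _ "X *\<^sub>v u"] atLeast0LessThan del: index_mult_mat_vec)
  qed
  have "((\<lambda>t. \<Sum>r<n. right_inv $$ (i, r) * (X *\<^sub>v \<beta> t) $ r) \<longlongrightarrow> (\<Sum>r<n. right_inv $$ (i, r) * (X *\<^sub>v v) $ r)) F"
    by (intro tendsto_sum tendsto_mult tendsto_const lim) auto
  moreover have "\<forall>\<^sub>F t in F. (\<Sum>r<n. right_inv $$ (i, r) * (X *\<^sub>v \<beta> t) $ r) = (P_par X *\<^sub>v \<beta> t) $ i"
    using dims(1) by eventually_elim (simp only: entry)
  ultimately show ?thesis
    unfolding entry[OF dims(2)] by (rule Lim_transform_eventually)
qed

lemma fine_tuning_limit:
  assumes n: "0 < n" and S: "\<theta>S \<in> carrier_vec d" "\<theta>S \<noteq> 0\<^sub>v d" and T: "\<theta>T \<in> carrier_vec d"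
    and ft: "fine_tuning d X \<theta>S \<theta>T L w \<Theta>"
  shows "\<exists>b. vec_tendsto (\<lambda>t. end_to_end L (\<Theta> t)) b at_top \<and>
     b = ((euclid_norm b / euclid_norm \<theta>S) powr ((real L - 1) / real L))
       \<cdot>\<^sub>v (P_perp X *\<^sub>v \<theta>S) + P_par X *\<^sub>v \<theta>T"
proof -
  have arch: "architecture d L w" and pre: "pretrained d L w \<theta>S (\<Theta> 0)"
    and init: "end_to_end L (\<Theta> 0) = \<theta>S"
    and gf: "gradient_flow L w (mse_loss L X (X *\<^sub>v \<theta>T)) \<Theta>"
    and loss: "((\<lambda>t. mse_loss L X (X *\<^sub>v \<theta>T) (\<Theta> t)) \<longlongrightarrow> 0) at_top"
    using ft unfolding fine_tuning_def by auto
  interpret balanced_flow d L w X "X *\<^sub>v \<theta>T" \<Theta>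
  proof
    show "zero_balanced L (\<Theta> 0)"
      using pretrained_zero_balanced[OF arch pre] gf unfolding gradient_flow_def by auto
  qed (use arch gf in \<open>auto simp: architecture_def\<close>)
  let ?Q = "P_perp X" and ?P = "P_par X"
  define \<beta> where "\<beta> t = end_to_end L (\<Theta> t)" for t
  define s where "s t = strength t" for t
  have Q: "dim_col ?Q = d" "?Q * transpose_mat X = 0\<^sub>m (dim_row ?Q) (dim_row X)"
    by (auto simp: P_perp_row_space)
  have \<beta>: "\<beta> t \<in> carrier_vec d" if "0 \<le> t" for t
    using linear_network.dim_end_to_end[OF network[OF that]] by (auto simp: \<beta>_def intro: carrier_vecI)
  have norm_\<beta>: "(euclid_norm (\<beta> t))\<^sup>2 = s t ^ L" if "0 \<le> t" for t
    using balanced_network.norm_end_to_end[OF balanced_net[OF that]] by (simp add: \<beta>_def s_def)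
  have \<theta>S_pos: "0 < euclid_norm \<theta>S"
    using S euclid_norm_eq_0_iff[of \<theta>S] euclid_norm_nonneg[of \<theta>S] by auto
  have norm_S: "(euclid_norm \<theta>S)\<^sup>2 = s 0 ^ L"
    using norm_\<beta>[of 0] init by (simp add: \<beta>_def)
  \<comment> \<open>\<open>0 ^ L\<close> would be 0 because \<open>L\<close> is at least 1.\<close>
  have "s 0 \<noteq> 0"
    using norm_S \<theta>S_pos depth by (auto simp: power_0_left)
  then have s0: "0 < s 0"
    using balanced_network.out_sq_nonneg[OF balanced_net[of 0]] by (simp add: s_def)
  define c where "c t = sqrt ((s t / s 0) ^ (L - 1))" for t
  have Q_\<beta>: "?Q *\<^sub>v \<beta> t = c t \<cdot>\<^sub>v (?Q *\<^sub>v \<theta>S)" if "0 \<le> t" for t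
    using perp_scaling[OF Q that] s0
    by (intro eq_vecI) (auto simp: c_def s_def \<beta>_def init simp del: index_mult_mat_vec)
  have P_lim: "((\<lambda>t. (?P *\<^sub>v \<beta> t) $ i) \<longlongrightarrow> (?P *\<^sub>v \<theta>T) $ i) at_top" if "i < d" for i
  proof (rule P_par_tendsto[OF _ _ T that])
    show "((\<lambda>t. (X *\<^sub>v \<beta> t) $ r) \<longlongrightarrow> (X *\<^sub>v \<theta>T) $ r) at_top" if "r < n" for r
      unfolding \<beta>_def by (rule mse_loss_tendsto_0[OF _ loss]) (use that n in auto)
    show "\<forall>\<^sub>F t in at_top. \<beta> t \<in> carrier_vec d"
      using eventually_ge_at_top[of 0] by eventually_elim (rule \<beta>)
  qed
  have decomp: "\<beta> t = c t \<cdot>\<^sub>v (?Q *\<^sub>v \<theta>S) + ?P *\<^sub>v \<beta> t" if "0 \<le> t" for t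
    using P_decomp[OF \<beta>[OF that]] Q_\<beta>[OF that] by simp
  \<comment> \<open>The assumption concerns the products, not \<open>c\<close> itself, so that it
    also holds when the perpendicular part of the source is zero.\<close>
  have limit: "vec_tendsto \<beta> (a \<cdot>\<^sub>v (?Q *\<^sub>v \<theta>S) + ?P *\<^sub>v \<theta>T) at_top"
    if c: "\<And>i. i < d \<Longrightarrow> ((\<lambda>t. c t * (?Q *\<^sub>v \<theta>S) $ i) \<longlongrightarrow> a * (?Q *\<^sub>v \<theta>S) $ i) at_top" for a
    unfolding vec_tendsto_def
  proof (intro conjI allI impI)
    show "\<forall>\<^sub>F t in at_top. dim_vec (\<beta> t) = dim_vec (a \<cdot>\<^sub>v (?Q *\<^sub>v \<theta>S) + ?P *\<^sub>v \<theta>T)"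
      using eventually_ge_at_top[of 0] by eventually_elim (use \<beta> in auto)
    fix i assume "i < dim_vec (a \<cdot>\<^sub>v (?Q *\<^sub>v \<theta>S) + ?P *\<^sub>v \<theta>T)"
    then have i: "i < d" by simp
    have "((\<lambda>t. c t * (?Q *\<^sub>v \<theta>S) $ i + (?P *\<^sub>v \<beta> t) $ i)
        \<longlongrightarrow> a * (?Q *\<^sub>v \<theta>S) $ i + (?P *\<^sub>v \<theta>T) $ i) at_top"
      by (intro tendsto_add c P_lim i)
    moreover have "\<forall>\<^sub>F t in at_top. c t * (?Q *\<^sub>v \<theta>S) $ i + (?P *\<^sub>v \<beta> t) $ i = \<beta> t $ i"
      using eventually_ge_at_top[of 0]
    proof eventually_elim
      case (elim t)
      show ?case
        using arg_cong[OF decomp[OF elim], of "\<lambda>v. v $ i"] i by (simp del: index_mult_mat_vec)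
    qed
    ultimately show "((\<lambda>t. \<beta> t $ i) \<longlongrightarrow> (a \<cdot>\<^sub>v (?Q *\<^sub>v \<theta>S) + ?P *\<^sub>v \<theta>T) $ i) at_top"
      using i by (auto intro: Lim_transform_eventually simp del: index_mult_mat_vec)
  qed
  show ?thesis
  proof (cases "?Q *\<^sub>v \<theta>S = 0\<^sub>v d")
    \<comment> \<open>Here \<kappa> would be 0, outside the scope of
      \<open>tendsto_of_shifted_power\<close>; but every coefficient gives the same vector, in
      particular the required power.\<close>
    case True
    define b where "b = 0 \<cdot>\<^sub>v (?Q *\<^sub>v \<theta>S) + ?P *\<^sub>v \<theta>T"
    have "vec_tendsto \<beta> b at_top"
      unfolding b_def by (rule limit) (simp add: True del: index_mult_mat_vec)
    moreover have "b = a \<cdot>\<^sub>v (?Q *\<^sub>v \<theta>S) + ?P *\<^sub>v \<theta>T" for a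
      unfolding b_def True by (intro eq_vecI) auto
    ultimately show ?thesis
      unfolding \<beta>_def[abs_def] by blast
  next
    case False
    define q where "q = euclid_norm (?Q *\<^sub>v \<theta>S)"
    \<comment> \<open>Chosen so that the squared perpendicular part of \<open>\<beta> t\<close> is
      \<open>\<kappa> * s t ^ (L - 1)\<close>.\<close>
    define \<kappa> where "\<kappa> = q\<^sup>2 / s 0 ^ (L - 1)"
    define g where "g t = (euclid_norm (?P *\<^sub>v \<beta> t))\<^sup>2" for t
    define p where "p = (euclid_norm (?P *\<^sub>v \<theta>T))\<^sup>2"
    have q: "0 < q"
      using False euclid_norm_eq_0_iff[of "?Q *\<^sub>v \<theta>S"] euclid_norm_nonneg[of "?Q *\<^sub>v \<theta>S"] by (auto simp: q_def)
    obtain i where i: "i < d" "(?Q *\<^sub>v \<theta>S) $ i \<noteq> 0"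
      using False by (metis eq_vecI index_zero_vec dim_mult_mat_vec dim_P(3))
    have s_pos: "0 < s t" if "0 \<le> t" for t
      using strength_pos[OF Q that, of i] i init by (simp add: s_def del: index_mult_mat_vec)
    have L: "s t ^ L = s t ^ (L - 1) * s t" for t
      using depth power_minus_mult[of L "s t"] by simp
    have "\<forall>\<^sub>F t in at_top. 0 < s t \<and> 0 \<le> g t \<and> s t ^ (L - 1) * (s t - \<kappa>) = g t"
      using eventually_ge_at_top[of 0]
    proof eventually_elim
      case (elim t)
      have "s t ^ L = (c t)\<^sup>2 * q\<^sup>2 + g t"
        using norm_\<beta>[OF elim] arg_cong[OF decomp[OF elim], of euclid_norm] norm_pythagoras[OF S(1) \<beta>[OF elim]]
        by (simp add: q_def g_def)
      moreover have "(c t)\<^sup>2 = s t ^ (L - 1) / s 0 ^ (L - 1)"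
        using s_pos[OF elim] s0 by (simp add: c_def power_divide)
      ultimately show ?case
        using s_pos[OF elim] by (simp add: L \<kappa>_def g_def algebra_simps)
    qed
    moreover have "(g \<longlongrightarrow> p) at_top"
      unfolding g_def p_def euclid_norm_sq by (auto intro!: tendsto_intros P_lim simp del: index_mult_mat_vec)
    ultimately obtain l where l: "\<kappa> \<le> l" "l ^ (L - 1) * (l - \<kappa>) = p" "(s \<longlongrightarrow> l) at_top"
      using tendsto_of_shifted_power[of \<kappa> s g "L - 1" at_top p] q s0 by (auto simp: \<kappa>_def p_def)
    have l_pos: "0 < l"
      using l(1) q s0 by (auto simp: \<kappa>_def intro: less_le_trans[rotated])
    define a where "a = sqrt ((l / s 0) ^ (L - 1))"
    define b where "b = a \<cdot>\<^sub>v (?Q *\<^sub>v \<theta>S) + ?P *\<^sub>v \<theta>T"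
    have "(c \<longlongrightarrow> a) at_top"
      unfolding c_def a_def using s0 by (intro tendsto_intros l) auto
    then have "vec_tendsto \<beta> b at_top"
      unfolding b_def by (intro limit tendsto_intros)
    moreover have "(euclid_norm b / euclid_norm \<theta>S) powr ((real L - 1) / real L) = a"
      unfolding a_def
    proof (rule powr_depth_exponent)
      have "(euclid_norm b)\<^sup>2 = a\<^sup>2 * q\<^sup>2 + p"
        unfolding b_def norm_pythagoras[OF S(1) T] by (simp add: q_def p_def)
      also have "a\<^sup>2 = l ^ (L - 1) / s 0 ^ (L - 1)"
        using l_pos s0 by (simp add: a_def power_divide)
      also have "l ^ (L - 1) / s 0 ^ (L - 1) * q\<^sup>2 + p = l ^ (L - 1) * l"
        unfolding l(2)[symmetric] by (simp add: \<kappa>_def algebra_simps)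
      also have "\<dots> = l ^ L"
        using depth power_minus_mult[of L l] by simp
      finally show "(euclid_norm b / euclid_norm \<theta>S)\<^sup>2 = (l / s 0) ^ L"
        using norm_S by (simp add: power_divide)
    qed (use l_pos s0 depth euclid_norm_nonneg in auto)
    ultimately show ?thesis
      unfolding \<beta>_def[abs_def] by (intro exI[of _ b]) (simp add: b_def)
  qed
qed

text \<open>Taking norms in the equation for \<open>b L\<close> and applying
  \<open>norm_pythagoras\<close> leaves the scalar equation of
  \<open>infinite_depth_coefficient\<close>.\<close>

lemma infinite_depth_limit:
  assumes S: "\<theta>S \<in> carrier_vec d" and T: "\<theta>T \<in> carrier_vec d" and nz: "P_par X *\<^sub>v \<theta>S \<noteq> 0\<^sub>v d"
    and b: "\<And>L. 1 \<le> L \<Longrightarrow> b L = ((euclid_norm (b L) / euclid_norm \<theta>S) powr ((real L - 1) / real L))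
       \<cdot>\<^sub>v (P_perp X *\<^sub>v \<theta>S) + P_par X *\<^sub>v \<theta>T"
  shows "vec_tendsto b ((euclid_norm (P_par X *\<^sub>v \<theta>T) / euclid_norm (P_par X *\<^sub>v \<theta>S))
     \<cdot>\<^sub>v (P_perp X *\<^sub>v \<theta>S) + P_par X *\<^sub>v \<theta>T) sequentially"
proof -
  let ?Q = "P_perp X" and ?P = "P_par X"
  define r where "r = euclid_norm (?P *\<^sub>v \<theta>S)"
  define p where "p = euclid_norm (?P *\<^sub>v \<theta>T)"
  define q where "q = euclid_norm (?Q *\<^sub>v \<theta>S)"
  define x where "x L = euclid_norm (b L) / euclid_norm \<theta>S" for L
  define c where "c L = x L powr ((real L - 1) / real L)" for L
  have b: "b L = c L \<cdot>\<^sub>v (?Q *\<^sub>v \<theta>S) + ?P *\<^sub>v \<theta>T" if "1 \<le> L" for L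
    using b[OF that] by (simp add: c_def x_def)
  have r: "0 < r"
    using nz euclid_norm_eq_0_iff[of "?P *\<^sub>v \<theta>S"] euclid_norm_nonneg[of "?P *\<^sub>v \<theta>S"] by (auto simp: r_def)
  have norm_S: "(euclid_norm \<theta>S)\<^sup>2 = r\<^sup>2 + q\<^sup>2"
    using norm_pythagoras[OF S S, of 1] P_decomp[OF S] by (simp add: r_def q_def one_smult_vec)
  have c: "(\<lambda>L. c L * (?Q *\<^sub>v \<theta>S) $ i) \<longlonglongrightarrow> p / r * (?Q *\<^sub>v \<theta>S) $ i" if "i < d" for i
  proof (cases "q = 0")
    \<comment> \<open>The source has no perpendicular part, so its coefficient has no influence on
      the limit.\<close>
    case True
    then have "(?Q *\<^sub>v \<theta>S) $ i = 0"
      using euclid_norm_eq_0_iff[of "?Q *\<^sub>v \<theta>S"] that by (metis q_def dim_mult_mat_vec dim_P(3) index_zero_vec(1))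
    then show ?thesis by (simp del: index_mult_mat_vec)
  next
    case False
    have "c \<longlonglongrightarrow> p / r"
      unfolding c_def
    proof (rule infinite_depth_coefficient[where q = q])
      show "0 < q" "0 < r" "0 \<le> p"
        using False r euclid_norm_nonneg[of "?Q *\<^sub>v \<theta>S"] euclid_norm_nonneg[of "?P *\<^sub>v \<theta>T"]
        by (auto simp: q_def p_def)
      fix L :: nat assume L: "1 \<le> L"
      show "0 \<le> x L" by (simp add: x_def euclid_norm_nonneg)
      have "(euclid_norm \<theta>S)\<^sup>2 * (x L)\<^sup>2 = (euclid_norm (b L))\<^sup>2"
        using norm_S r by (auto simp: x_def power_divide sum_power2_eq_zero_iff)
      also have "\<dots> = p\<^sup>2 + (c L)\<^sup>2 * q\<^sup>2"
        unfolding arg_cong[OF b[OF L], of euclid_norm] norm_pythagoras[OF S T] by (simp add: p_def q_def)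
      finally show "(r\<^sup>2 + q\<^sup>2) * (x L)\<^sup>2 = p\<^sup>2 + (x L powr ((real L - 1) / real L))\<^sup>2 * q\<^sup>2"
        by (simp add: norm_S c_def)
    qed
    then show ?thesis by (intro tendsto_intros)
  qed
  show ?thesis
    unfolding vec_tendsto_def p_def[symmetric] r_def[symmetric]
  proof (intro conjI allI impI)
    show "\<forall>\<^sub>F L in sequentially. dim_vec (b L) = dim_vec ((p / r) \<cdot>\<^sub>v (?Q *\<^sub>v \<theta>S) + ?P *\<^sub>v \<theta>T)"
      by (rule eventually_sequentiallyI[of 1]) (subst b, auto)
    fix i assume "i < dim_vec ((p / r) \<cdot>\<^sub>v (?Q *\<^sub>v \<theta>S) + ?P *\<^sub>v \<theta>T)"
    then have i: "i < d" by simp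
    have "(\<lambda>L. c L * (?Q *\<^sub>v \<theta>S) $ i + (?P *\<^sub>v \<theta>T) $ i)
        \<longlonglongrightarrow> p / r * (?Q *\<^sub>v \<theta>S) $ i + (?P *\<^sub>v \<theta>T) $ i"
      by (intro tendsto_add c i tendsto_const)
    moreover have "\<forall>\<^sub>F L in sequentially. c L * (?Q *\<^sub>v \<theta>S) $ i + (?P *\<^sub>v \<theta>T) $ i = b L $ i"
      by (rule eventually_sequentiallyI[of 1]) (subst b, use i in \<open>auto simp del: index_mult_mat_vec\<close>)
    ultimately show "(\<lambda>L. b L $ i) \<longlonglongrightarrow> ((p / r) \<cdot>\<^sub>v (?Q *\<^sub>v \<theta>S) + ?P *\<^sub>v \<theta>T) $ i"
      using i by (auto intro: Lim_transform_eventually simp del: index_mult_mat_vec)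
  qed
qed

end

theorem theorem5p2:
  fixes n d :: nat and X :: "real mat" and \<theta>S \<theta>T :: "real vec"
  assumes "0 < n" and "n < d"
    and "X \<in> carrier_mat n d"
    and "invertible_mat (X * transpose_mat X)"
    and "\<theta>S \<in> carrier_vec d" and "\<theta>T \<in> carrier_vec d"
    and "\<theta>S \<noteq> 0\<^sub>v d"
  shows "(\<forall>L w \<Theta>. fine_tuning d X \<theta>S \<theta>T L w \<Theta> \<longrightarrow>
            (\<exists>b. vec_tendsto (\<lambda>t. end_to_end L (\<Theta> t)) b at_top \<and>
                 b = ((euclid_norm b / euclid_norm \<theta>S) powr ((real L - 1) / real L))
                       \<cdot>\<^sub>v (P_perp X *\<^sub>v \<theta>S) + P_par X *\<^sub>v \<theta>T))
       \<and> (P_par X *\<^sub>v \<theta>S \<noteq> 0\<^sub>v d \<longrightarrow>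
            (\<forall>w \<Theta>. (\<forall>L\<ge>1. fine_tuning d X \<theta>S \<theta>T L (w L) (\<Theta> L)) \<longrightarrow>
               (\<exists>b. (\<forall>L\<ge>1. vec_tendsto (\<lambda>t. end_to_end L (\<Theta> L t)) (b L) at_top) \<and>
                    vec_tendsto b
                      ((euclid_norm (P_par X *\<^sub>v \<theta>T) / euclid_norm (P_par X *\<^sub>v \<theta>S))
                         \<cdot>\<^sub>v (P_perp X *\<^sub>v \<theta>S) + P_par X *\<^sub>v \<theta>T) sequentially)))"
proof -
  interpret full_row_rank n d X
    using assms by unfold_locales
  note limit = fine_tuning_limit[OF assms(1,5,7,6)]
  show ?thesis
  proof (intro conjI allI impI)
    fix w :: "nat \<Rightarrow> nat \<Rightarrow> nat" and \<Theta> :: "nat \<Rightarrow> real \<Rightarrow> nat \<Rightarrow> real mat"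
    assume nz: "P_par X *\<^sub>v \<theta>S \<noteq> 0\<^sub>v d"
      and ft: "\<forall>L\<ge>1. fine_tuning d X \<theta>S \<theta>T L (w L) (\<Theta> L)"
    \<comment> \<open>The guard on \<open>L\<close> stands inside the existential, so that choice
      gives a sequence on all of \<open>nat\<close>; its value at 0 is arbitrary.\<close>
    have "\<forall>L. \<exists>b. 1 \<le> L \<longrightarrow> vec_tendsto (\<lambda>t. end_to_end L (\<Theta> L t)) b at_top \<and>
        b = ((euclid_norm b / euclid_norm \<theta>S) powr ((real L - 1) / real L))
          \<cdot>\<^sub>v (P_perp X *\<^sub>v \<theta>S) + P_par X *\<^sub>v \<theta>T"
      using limit ft by blast
    then obtain b where b: "\<And>L. 1 \<le> L \<Longrightarrow> vec_tendsto (\<lambda>t. end_to_end L (\<Theta> L t)) (b L) at_top"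
      and eq: "\<And>L. 1 \<le> L \<Longrightarrow> b L = ((euclid_norm (b L) / euclid_norm \<theta>S) powr ((real L - 1) / real L))
          \<cdot>\<^sub>v (P_perp X *\<^sub>v \<theta>S) + P_par X *\<^sub>v \<theta>T"
      by metis
    show "\<exists>b. (\<forall>L\<ge>1. vec_tendsto (\<lambda>t. end_to_end L (\<Theta> L t)) (b L) at_top) \<and>
        vec_tendsto b ((euclid_norm (P_par X *\<^sub>v \<theta>T) / euclid_norm (P_par X *\<^sub>v \<theta>S))
          \<cdot>\<^sub>v (P_perp X *\<^sub>v \<theta>S) + P_par X *\<^sub>v \<theta>T) sequentially"
      using b infinite_depth_limit[OF assms(5,6) nz eq] by blast
  qed (rule limit)
qed

end
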